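(* There is a universal constant $C>0$ such that for all integers $n,T,\kappa\ge 1$ and every $L>0$ there is a learner's strategy for the $T$-round online learning problem for $n$-qubit states such that, for every (possibly adaptive) adversary choosing convex $L$-Lipschitz loss functions $\ell_t:\mathbb{R}\to\mathbb{R}$ and $\kappa$-sparse effects $E_t$ for all $t\in\{1,\dots,T\}$, the regret satisfies \[ R_T\;\le\; C\,L\,\sqrt{\min\{\kappa,n\}\,T}. \]
   Context: Let $\mathrm{D}_n$ be the set of $n$-qubit quantum states, i.e. $2^n\times 2^n$ complex positive semidefinite matrices of trace one. An effect is a $2^n\times 2^n$ Hermitian matrix $E$ with $0\preceq E\preceq \mathbb{1}$. An effect is $\kappa$-sparse if, as a matrix in the fixed standard basis, it has at most $\kappa$ nonzero entries in total. Online protocol: in each round $t=1,\dots,T$ the learner outputs $\omega_t\in\mathrm{D}_n$ (as a function of the previously revealed $(E_s,\ell_s)_{s<t}$ and of the parameters $n,T,\kappa,L$); then the adversary reveals an effect $E_t$ and a loss function $\ell_t$, and the learner incurs loss $\ell_t(\operatorname{tr}(E_t\omega_t))$. The regret is \[ R_T=\sum_{t=1}^T \ell_t\big(\operatorname{tr}(E_t\omega_t)\big)-\min_{\omega\in\mathrm{D}_n}\sum_{t=1}^T \ell_t\big(\operatorname{tr}(E_t\omega)\big), \] and the bound is required for every possible sequence of adversary choices. *)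

theory Defs
  imports
    "HOL-Analysis.Convex"
    "HOL-Analysis.Lipschitz"
    "Jordan_Normal_Form.Schur_Decomposition"
begin

definition mat_trace :: "complex mat \<Rightarrow> complex" where
  "mat_trace A = (\<Sum>i<dim_row A. A $$ (i, i))"

definition hermitian_mat :: "nat \<Rightarrow> complex mat \<Rightarrow> bool" where
  "hermitian_mat d A \<longleftrightarrow> A \<in> carrier_mat d d \<and> mat_adjoint A = A"

(* The order on complex numbers is that of Complex_Order: 0 \<le> z says that z is real and
   nonnegative. *)
definition psd_mat :: "nat \<Rightarrow> complex mat \<Rightarrow> bool" where
  "psd_mat d A \<longleftrightarrow> hermitian_mat d A \<and> (\<forall>v\<in>carrier_vec d. 0 \<le> (A *\<^sub>v v) \<bullet>c v)"

definition quantum_states :: "nat \<Rightarrow> complex mat set" where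
  "quantum_states n = {\<omega>. psd_mat (2 ^ n) \<omega> \<and> mat_trace \<omega> = 1}"

definition effects :: "nat \<Rightarrow> complex mat set" where
  "effects n = {E. hermitian_mat (2 ^ n) E \<and> psd_mat (2 ^ n) E \<and> psd_mat (2 ^ n) (1\<^sub>m (2 ^ n) - E)}"

definition sparse_mat :: "nat \<Rightarrow> complex mat \<Rightarrow> bool" where
  "sparse_mat \<kappa> A \<longleftrightarrow> card {(i, j). i < dim_row A \<and> j < dim_col A \<and> A $$ (i, j) \<noteq> 0} \<le> \<kappa>"

(* For Hermitian E and \<omega> the trace of E * \<omega> is real, so taking the real part only changes the
   type. *)
definition expect_val :: "complex mat \<Rightarrow> complex mat \<Rightarrow> real" where
  "expect_val E \<omega> = Re (mat_trace (E * \<omega>))"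

type_synonym adv_move = "complex mat \<times> (real \<Rightarrow> real)"

type_synonym transcript = "(complex mat \<times> adv_move) list"

(* A learner sees the earlier adversary moves, oldest first; the current round is one plus the
   length of that list.  Its own earlier outputs are determined by them. *)
type_synonym learner = "adv_move list \<Rightarrow> complex mat"

(* An adaptive adversary sees all earlier rounds and the state just output by the learner. *)
type_synonym adversary = "transcript \<Rightarrow> complex mat \<Rightarrow> adv_move"

primrec play :: "learner \<Rightarrow> adversary \<Rightarrow> nat \<Rightarrow> transcript" where
  "play A B 0 = []"
| "play A B (Suc t) =
     (let h = play A B t; \<omega> = A (map snd h) in h @ [(\<omega>, B h \<omega>)])"

(* For continuous losses the infimum is attained, because the set of states is nonempty and
   compact; it is then the minimum over all states. *)
definition regret :: "nat \<Rightarrow> transcript \<Rightarrow> real" where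
  "regret n h =
     (\<Sum>(\<omega>, E, l)\<leftarrow>h. l (expect_val E \<omega>))
     - (INF \<sigma>\<in>quantum_states n. \<Sum>(\<omega>, E, l)\<leftarrow>h. l (expect_val E \<sigma>))"

end

theory Submission
  imports Defs
begin

text \<open>
  The learner runs follow-the-regularized-leader on the linearized losses: with \<open>A\<close> minus \<open>\<eta>\<close> times the
  sum of the past subgradients, it plays the gradient at \<open>A\<close> of the potential
  \<open>V A = min\<^sub>\<tau> (\<tau> + tr f (A - \<tau>))\<close>, a state because the optimal \<open>\<tau>\<close> satisfies \<open>tr f' (A - \<tau>) = 1\<close>.
  Klein's inequality with a second order remainder bounds the growth of \<open>V\<close> by its linear part plus a
  quadratic term. For \<open>f x = (max x 0)\<^sup>2 / 2\<close> that term is the squared Frobenius norm of the increment;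
  a \<open>\<kappa>\<close>-sparse effect has entries of modulus at most 1, hence Frobenius norm at most \<open>\<surd>\<kappa>\<close>, which
  gives regret \<open>L \<surd>(\<kappa> T)\<close>. For \<open>f = exp\<close> (matrix multiplicative weights) it involves only
  the operator norm, while \<open>V 0\<close> is about \<open>n ln 2\<close>, which gives regret of order \<open>L \<surd>(n T)\<close> when \<open>n \<le> T\<close>;
  for \<open>n > T\<close> the trivial bound \<open>L T\<close> suffices.
\<close>

section \<open>Spectral decomposition of Hermitian matrices\<close>

text \<open>Vectors are functions of which only the values below \<open>d\<close> count; no carrier
  conditions arise, and equality of vectors means equality below \<open>d\<close>.\<close>

definition cinner :: "nat \<Rightarrow> (nat \<Rightarrow> complex) \<Rightarrow> (nat \<Rightarrow> complex) \<Rightarrow> complex" where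
  "cinner d x y = (\<Sum>k<d. x k * cnj (y k))"

definition mat_app :: "nat \<Rightarrow> complex mat \<Rightarrow> (nat \<Rightarrow> complex) \<Rightarrow> nat \<Rightarrow> complex" where
  "mat_app d A x = (\<lambda>k. \<Sum>l<d. A $$ (k, l) * x l)"

definition sqnorm :: "nat \<Rightarrow> (nat \<Rightarrow> complex) \<Rightarrow> real" where
  "sqnorm d x = (\<Sum>k<d. (cmod (x k))\<^sup>2)"

lemma cinner_self: "cinner d x x = of_real (sqnorm d x)"
  by (simp add: cinner_def sqnorm_def complex_norm_square del: of_real_power)

lemma sqnorm_nonneg: "0 \<le> sqnorm d x"
  by (simp add: sqnorm_def sum_nonneg)

lemma sqnorm_eq_0_iff: "sqnorm d x = 0 \<longleftrightarrow> (\<forall>k<d. x k = 0)"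
  by (auto simp: sqnorm_def sum_nonneg_eq_0_iff)

lemma cnj_cinner: "cnj (cinner d x y) = cinner d y x"
  by (simp add: cinner_def mult.commute)

lemma cinner_scale_left: "cinner d (\<lambda>k. c * x k) y = c * cinner d x y"
  by (simp add: cinner_def sum_distrib_left mult.assoc)

lemma cinner_scale_right: "cinner d x (\<lambda>k. c * y k) = cnj c * cinner d x y"
  by (simp add: cinner_def sum_distrib_left algebra_simps)

lemma cinner_cong:
  "(\<And>k. k < d \<Longrightarrow> x k = x' k) \<Longrightarrow> (\<And>k. k < d \<Longrightarrow> y k = y' k) \<Longrightarrow> cinner d x y = cinner d x' y'"
  by (simp add: cinner_def)

lemma hermitian_mat_iff:
  "hermitian_mat d A \<longleftrightarrow>
    A \<in> carrier_mat d d \<and> (\<forall>k<d. \<forall>l<d. A $$ (l, k) = cnj (A $$ (k, l)))"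
proof (cases "A \<in> carrier_mat d d")
  case True
  have adj: "mat_adjoint A \<in> carrier_mat d d"
    using True by (auto simp: mat_adjoint_def mat_of_rows_def)
  have "mat_adjoint A $$ (k, l) = cnj (A $$ (l, k))" if "k < d" "l < d" for k l
    using True that by (auto simp: mat_adjoint_def mat_of_rows_index)
  then have "mat_adjoint A = A \<longleftrightarrow> (\<forall>k<d. \<forall>l<d. cnj (A $$ (l, k)) = A $$ (k, l))"
    using True adj by (auto simp: mat_eq_iff)
  also have "\<dots> \<longleftrightarrow> (\<forall>k<d. \<forall>l<d. A $$ (l, k) = cnj (A $$ (k, l)))"
    by (metis complex_cnj_cnj)
  finally show ?thesis
    using True by (simp add: hermitian_mat_def)
qed (simp add: hermitian_mat_def)

lemma hermitian_mat_entry: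
  "hermitian_mat d A \<Longrightarrow> k < d \<Longrightarrow> l < d \<Longrightarrow> A $$ (l, k) = cnj (A $$ (k, l))"
  unfolding hermitian_mat_iff by blast

lemma cinner_mat_app_hermitian:
  assumes "hermitian_mat d A"
  shows "cinner d (mat_app d A x) y = cinner d x (mat_app d A y)"
proof -
  have "cinner d (mat_app d A x) y = (\<Sum>k<d. \<Sum>l<d. A $$ (k, l) * x l * cnj (y k))"
    by (simp add: cinner_def mat_app_def sum_distrib_right)
  also have "\<dots> = (\<Sum>l<d. \<Sum>k<d. A $$ (k, l) * x l * cnj (y k))"
    by (rule sum.swap)
  also have "\<dots> = cinner d x (mat_app d A y)"
    unfolding cinner_def mat_app_def cnj_sum sum_distrib_left
  proof (intro sum.cong refl)
    fix l k assume "l \<in> {..<d}" "k \<in> {..<d}"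
    then have "A $$ (k, l) = cnj (A $$ (l, k))"
      using hermitian_mat_entry[OF assms] by blast
    then show "A $$ (k, l) * x l * cnj (y k) = x l * cnj (A $$ (l, k) * y k)"
      by (simp add: mult.commute)
  qed
  finally show ?thesis .
qed

lemma mat_trace_mult_commute:
  assumes "A \<in> carrier_mat n m" "B \<in> carrier_mat m n"
  shows "mat_trace (A * B) = mat_trace (B * A)"
proof -
  have "mat_trace (A * B) = (\<Sum>i<n. \<Sum>j<m. A $$ (i, j) * B $$ (j, i))"
    using assms by (auto simp: mat_trace_def scalar_prod_def atLeast0LessThan intro!: sum.cong)
  also have "\<dots> = (\<Sum>j<m. \<Sum>i<n. A $$ (i, j) * B $$ (j, i))"
    by (rule sum.swap)
  also have "\<dots> = mat_trace (B * A)"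
    using assms by (auto simp: mat_trace_def scalar_prod_def atLeast0LessThan mult.commute intro!: sum.cong)
  finally show ?thesis .
qed

text \<open>If all roots of the characteristic polynomial were \<open>c\<close>, the trace would be \<open>d * c\<close>.\<close>

lemma exists_eigenvector_neq:
  assumes A: "A \<in> carrier_mat d d" and tr: "mat_trace A \<noteq> of_nat d * c"
  obtains e x where "e \<noteq> c" "sqnorm d x \<noteq> 0" "\<And>k. k < d \<Longrightarrow> mat_app d A x k = e * x k"
proof -
  obtain es where es: "char_poly A = (\<Prod>e\<leftarrow>es. [:- e, 1:])" and len: "length es = d"
    using char_poly_factorized[OF A] by auto
  \<comment> \<open>The trace is invariant under similarity, and the diagonal of the Schur form
    lists the roots of the characteristic polynomial; so the trace is the sum of these
    roots.\<close>
  obtain B P Q where "schur_decomposition A es = (B, P, Q)"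
    by (cases "schur_decomposition A es")
  from schur_decomposition[OF A es this]
  have sim: "similar_mat_wit A B P Q" and diag: "diag_mat B = es" by auto
  note w = similar_mat_witD2[OF A sim]
  have "mat_trace A = mat_trace (P * (B * Q))"
    using w by (simp add: assoc_mult_mat[of P d d B d Q d])
  also have "\<dots> = mat_trace (B * Q * P)"
    using w by (intro mat_trace_mult_commute[of _ d d]) auto
  also have "B * Q * P = B"
    using w by (simp add: assoc_mult_mat[of B d d Q d P d])
  also have "mat_trace B = sum_list es"
    using w by (auto simp: diag[symmetric] mat_trace_def diag_mat_def sum_list_sum_nth atLeast0LessThan)
  finally have "\<not> (\<forall>e\<in>set es. e = c)"
    using tr len by (metis replicate_length_same sum_list_replicate of_nat_id)
  then obtain e where e: "e \<in> set es" "e \<noteq> c" by auto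
  have "poly (char_poly A) e = 0"
    using e by (auto simp: es poly_prod_list prod_list_zero_iff)
  then obtain v where v: "eigenvector A v e"
    using eigenvalue_root_char_poly[OF A] by (auto simp: eigenvalue_def)
  then have vc: "v \<in> carrier_vec d" and v0: "v \<noteq> 0\<^sub>v d" and Av: "A *\<^sub>v v = e \<cdot>\<^sub>v v"
    using A by (auto simp: eigenvector_def)
  have "mat_app d A (\<lambda>k. v $ k) k = (A *\<^sub>v v) $ k" if "k < d" for k
    using A vc that by (auto simp: mat_app_def scalar_prod_def atLeast0LessThan intro!: sum.cong)
  then have "mat_app d A (\<lambda>k. v $ k) k = e * v $ k" if "k < d" for k
    using that vc Av by simp
  moreover have "sqnorm d (\<lambda>k. v $ k) \<noteq> 0"
    using v0 vc by (auto simp: sqnorm_eq_0_iff vec_eq_iff)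
  ultimately show thesis
    using that e by blast
qed

text \<open>Induction on the number of eigenvectors. With \<open>n < d\<close> of them found, the
  trace of the deflated matrix \<open>M\<close> has imaginary part \<open>n\<close> rather than
  \<open>d\<close>, so \<open>M\<close> has an eigenvalue other than \<open>\<i>\<close>. Its
  eigenvector is orthogonal to the known ones, hence an eigenvector of \<open>A\<close>, and
  self-adjointness makes the eigenvalue real.\<close>

lemma orthonormal_eigenvectors:
  assumes A: "hermitian_mat d A" and "n \<le> d"
  shows "\<exists>u (ev :: nat \<Rightarrow> real).
    (\<forall>i<n. \<forall>j<n. cinner d (u i) (u j) = (if i = j then 1 else 0)) \<and>
    (\<forall>i<n. \<forall>k<d. mat_app d A (u i) k = ev i * u i k)"
  using \<open>n \<le> d\<close>
proof (induction n)
  case 0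
  show ?case by simp
next
  case (Suc n)
  then obtain u :: "nat \<Rightarrow> nat \<Rightarrow> complex" and ev :: "nat \<Rightarrow> real" where
    orth: "\<And>i j. i < n \<Longrightarrow> j < n \<Longrightarrow> cinner d (u i) (u j) = (if i = j then 1 else 0)" and
    eig: "\<And>i k. i < n \<Longrightarrow> k < d \<Longrightarrow> mat_app d A (u i) k = ev i * u i k"
    by (metis Suc_leD)
  have Ac: "A \<in> carrier_mat d d"
    using A by (simp add: hermitian_mat_def)
  \<comment> \<open>Deflation: moving the known real eigenvalues to \<open>\<i>\<close> separates them from the remaining ones.\<close>
  define M where
    "M = mat d d (\<lambda>(k, l). A $$ (k, l) - (\<Sum>i<n. (of_real (ev i) - \<i>) * (u i k * cnj (u i l))))"
  have "mat_trace M = (\<Sum>k<d. A $$ (k, k)) -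
      (\<Sum>k<d. \<Sum>i<n. (of_real (ev i) - \<i>) * (u i k * cnj (u i k)))"
    by (simp add: mat_trace_def M_def sum_subtractf)
  also have "(\<Sum>k<d. \<Sum>i<n. (of_real (ev i) - \<i>) * (u i k * cnj (u i k))) =
      (\<Sum>i<n. (of_real (ev i) - \<i>) * cinner d (u i) (u i))"
    by (subst sum.swap) (simp add: cinner_def sum_distrib_left)
  also have "\<dots> = (\<Sum>i<n. of_real (ev i) - \<i>)"
    by (intro sum.cong) (simp_all add: orth)
  finally have "Im (mat_trace M) = Im (\<Sum>k<d. A $$ (k, k)) + real n"
    by simp
  moreover have "Im (A $$ (k, k)) = 0" if "k < d" for k
  proof -
    have "A $$ (k, k) = cnj (A $$ (k, k))"
      using hermitian_mat_entry[OF A] that by blast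
    then show ?thesis
      by (metis Reals_cnj_iff complex_is_Real_iff)
  qed
  ultimately have "Im (mat_trace M) = real n"
    by simp
  then have "mat_trace M \<noteq> of_nat d * \<i>"
    using Suc.prems by auto
  then obtain e x where e: "e \<noteq> \<i>" and x: "sqnorm d x \<noteq> 0"
    and Mx: "\<And>k. k < d \<Longrightarrow> mat_app d M x k = e * x k"
    using exists_eigenvector_neq[of M d \<i>] by (auto simp: M_def)
  have Mx': "mat_app d M x k = mat_app d A x k - (\<Sum>i<n. (of_real (ev i) - \<i>) * cinner d x (u i) * u i k)"
    if "k < d" for k
  proof -
    have "mat_app d M x k = mat_app d A x k -
       (\<Sum>l<d. \<Sum>i<n. (of_real (ev i) - \<i>) * (u i k * cnj (u i l)) * x l)"
      using that by (simp add: mat_app_def M_def algebra_simps sum_subtractf sum_distrib_right sum_distrib_left)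
    also have "(\<Sum>l<d. \<Sum>i<n. (of_real (ev i) - \<i>) * (u i k * cnj (u i l)) * x l) =
      (\<Sum>i<n. (of_real (ev i) - \<i>) * cinner d x (u i) * u i k)"
      by (subst sum.swap) (simp add: cinner_def sum_distrib_left sum_distrib_right algebra_simps)
    finally show ?thesis .
  qed
  \<comment> \<open>Pair the eigenvector equation of \<open>M\<close> with \<open>u j\<close>: one
    side is \<open>e\<close> times the overlap, the other is \<open>\<i>\<close> times it, because
    \<open>A\<close> is self-adjoint and the deflation replaces \<open>ev j\<close> by
    \<open>\<i>\<close>. As \<open>e \<noteq> \<i>\<close>, the overlap vanishes.\<close>
  have orthx: "cinner d x (u j) = 0" if j: "j < n" for j
  proof -
    have "e * cinner d x (u j) = cinner d (mat_app d M x) (u j)"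
      by (subst cinner_scale_left[symmetric]) (auto intro!: cinner_cong simp: Mx)
    also have "\<dots> = cinner d (\<lambda>k. mat_app d A x k - (\<Sum>i<n. (of_real (ev i) - \<i>) * cinner d x (u i) * u i k)) (u j)"
      by (intro cinner_cong) (auto simp: Mx')
    also have "\<dots> = cinner d (mat_app d A x) (u j) -
      (\<Sum>k<d. \<Sum>i<n. (of_real (ev i) - \<i>) * cinner d x (u i) * (u i k * cnj (u j k)))"
      by (simp add: cinner_def left_diff_distrib sum_subtractf sum_distrib_right sum_distrib_left mult.assoc)
    also have "(\<Sum>k<d. \<Sum>i<n. (of_real (ev i) - \<i>) * cinner d x (u i) * (u i k * cnj (u j k))) =
      (\<Sum>i<n. (of_real (ev i) - \<i>) * cinner d x (u i) * cinner d (u i) (u j))"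
      by (subst sum.swap) (simp add: cinner_def[of d "u _" "u j"] sum_distrib_left)
    also have "\<dots> = (\<Sum>i<n. if i = j then (of_real (ev i) - \<i>) * cinner d x (u i) else 0)"
      by (intro sum.cong) (auto simp: orth j)
    also have "\<dots> = (of_real (ev j) - \<i>) * cinner d x (u j)"
      using j by simp
    also have "cinner d (mat_app d A x) (u j) = cinner d x (mat_app d A (u j))"
      by (rule cinner_mat_app_hermitian[OF A])
    also have "\<dots> = cinner d x (\<lambda>k. of_real (ev j) * u j k)"
      using j by (intro cinner_cong) (auto simp: eig)
    also have "\<dots> = of_real (ev j) * cinner d x (u j)"
      by (simp add: cinner_scale_right)
    finally have "(e - \<i>) * cinner d x (u j) = 0"
      by (simp add: algebra_simps)
    then show ?thesis using e by simp
  qed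
  have Ax: "mat_app d A x k = e * x k" if "k < d" for k
    using Mx[OF that] Mx'[OF that] orthx by simp
  have "e * cinner d x x = cinner d (mat_app d A x) x"
    by (subst cinner_scale_left[symmetric]) (auto intro!: cinner_cong simp: Ax)
  also have "\<dots> = cinner d x (\<lambda>k. e * x k)"
    by (subst cinner_mat_app_hermitian[OF A]) (auto intro!: cinner_cong simp: Ax)
  also have "\<dots> = cnj e * cinner d x x"
    by (simp add: cinner_scale_right)
  finally have "e = cnj e"
    using x by (simp add: cinner_self)
  then have e_real: "e = of_real (Re e)"
    by (metis Reals_cnj_iff of_real_Re)
  define c where "c = complex_of_real (1 / sqrt (sqnorm d x))"
  define y where "y = (\<lambda>k. c * x k)"
  have "cinner d y y = c * (cnj c * of_real (sqnorm d x))"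
    by (simp only: y_def cinner_scale_left cinner_scale_right cinner_self)
  also have "\<dots> = of_real (sqnorm d x / (sqrt (sqnorm d x))\<^sup>2)"
    unfolding c_def complex_cnj_complex_of_real by (simp flip: of_real_mult add: power2_eq_square)
  also have "\<dots> = 1"
    using x sqnorm_nonneg[of d x] by simp
  finally have yy: "cinner d y y = 1" .
  have yu: "cinner d y (u j) = 0" "cinner d (u j) y = 0" if "j < n" for j
    using orthx[OF that] cnj_cinner[of d x "u j"]
    by (simp_all add: y_def cinner_scale_left cinner_scale_right)
  have Ay: "mat_app d A y k = Re e * y k" if "k < d" for k
  proof -
    have "mat_app d A y k = c * mat_app d A x k"
      by (simp add: mat_app_def y_def sum_distrib_left algebra_simps)
    then show ?thesis
      using Ax[OF that] e_real by (simp add: y_def)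
  qed
  show ?case
    by (rule exI[of _ "u(n := y)"], rule exI[of _ "ev(n := Re e)"])
      (auto simp: less_Suc_eq orth eig yy yu Ay)
qed

text \<open>The middle clause is the resolution of the identity, the form of completeness behind
  \<open>parseval\<close>.\<close>

definition eigenbasis :: "nat \<Rightarrow> complex mat \<Rightarrow> (nat \<Rightarrow> nat \<Rightarrow> complex) \<Rightarrow> (nat \<Rightarrow> real) \<Rightarrow> bool" where
  "eigenbasis d A u ev \<longleftrightarrow>
    (\<forall>i<d. \<forall>j<d. cinner d (u i) (u j) = (if i = j then 1 else 0)) \<and>
    (\<forall>k<d. \<forall>l<d. (\<Sum>i<d. u i k * cnj (u i l)) = (if k = l then 1 else 0)) \<and>
    (\<forall>i<d. \<forall>k<d. mat_app d A (u i) k = ev i * u i k)"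

theorem hermitian_eigenbasis:
  assumes "hermitian_mat d A"
  obtains u ev where "eigenbasis d A u ev"
proof -
  obtain u :: "nat \<Rightarrow> nat \<Rightarrow> complex" and ev :: "nat \<Rightarrow> real" where
    orth: "\<And>i j. i < d \<Longrightarrow> j < d \<Longrightarrow> cinner d (u i) (u j) = (if i = j then 1 else 0)" and
    eig: "\<And>i k. i < d \<Longrightarrow> k < d \<Longrightarrow> mat_app d A (u i) k = ev i * u i k"
    using orthonormal_eigenvectors[OF assms order.refl] by metis
  \<comment> \<open>Orthonormality says that \<open>U * V\<close> is the identity; a one-sided
    inverse of a square matrix is two-sided, and the other product gives completeness.\<close>
  define U V where "U = mat d d (\<lambda>(i, k). u i k)" and "V = mat d d (\<lambda>(k, i). cnj (u i k))"
  have "U * V = 1\<^sub>m d"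
    by (rule eq_matI) (auto simp: U_def V_def scalar_prod_def atLeast0LessThan orth[unfolded cinner_def])
  then have VU: "V * U = 1\<^sub>m d"
    by (intro mat_mult_left_right_inverse[of U]) (auto simp: U_def V_def)
  have "(\<Sum>i<d. u i k * cnj (u i l)) = (if k = l then 1 else 0)" if "k < d" "l < d" for k l
  proof -
    have "(\<Sum>i<d. u i k * cnj (u i l)) = (V * U) $$ (l, k)"
      using that by (simp add: U_def V_def scalar_prod_def atLeast0LessThan mult.commute)
    then show ?thesis
      using that by (simp add: VU)
  qed
  then have "eigenbasis d A u ev"
    using orth eig by (auto simp: eigenbasis_def)
  then show thesis by (rule that)
qed

section \<open>Klein's inequality\<close>

lemma eigenbasis_orthonormal:
  "eigenbasis d A u ev \<Longrightarrow> i < d \<Longrightarrow> j < d \<Longrightarrow> cinner d (u i) (u j) = (if i = j then 1 else 0)"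
  by (simp add: eigenbasis_def)

lemma eigenbasis_sqnorm: "eigenbasis d A u ev \<Longrightarrow> i < d \<Longrightarrow> sqnorm d (u i) = 1"
  using cinner_self[of d "u i"] by (simp add: eigenbasis_orthonormal)

lemma eigenbasis_complete:
  "eigenbasis d A u ev \<Longrightarrow> k < d \<Longrightarrow> l < d \<Longrightarrow> (\<Sum>i<d. u i k * cnj (u i l)) = (if k = l then 1 else 0)"
  by (simp add: eigenbasis_def)

lemma eigenbasis_eigen:
  "eigenbasis d A u ev \<Longrightarrow> i < d \<Longrightarrow> k < d \<Longrightarrow> mat_app d A (u i) k = ev i * u i k"
  by (simp add: eigenbasis_def)

lemma parseval:
  assumes "eigenbasis d A u ev"
  shows "(\<Sum>j<d. cinner d x (u j) * cnj (cinner d y (u j))) = cinner d x y"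
proof -
  have "(\<Sum>j<d. cinner d x (u j) * cnj (cinner d y (u j)))
      = (\<Sum>j<d. \<Sum>k<d. \<Sum>l<d. x k * cnj (y l) * (u j l * cnj (u j k)))"
    by (simp add: cinner_def sum_product algebra_simps)
  also have "\<dots> = (\<Sum>k<d. \<Sum>j<d. \<Sum>l<d. x k * cnj (y l) * (u j l * cnj (u j k)))"
    by (rule sum.swap)
  also have "\<dots> = (\<Sum>k<d. \<Sum>l<d. \<Sum>j<d. x k * cnj (y l) * (u j l * cnj (u j k)))"
    by (intro sum.cong refl sum.swap)
  also have "\<dots> = (\<Sum>k<d. \<Sum>l<d. x k * cnj (y l) * (if l = k then 1 else 0))"
    by (simp add: sum_distrib_left[symmetric] eigenbasis_complete[OF assms])
  also have "\<dots> = cinner d x y"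
    by (simp add: cinner_def if_distrib cong: if_cong)
  finally show ?thesis .
qed

lemma sqnorm_parseval:
  assumes "eigenbasis d A u ev"
  shows "(\<Sum>j<d. (cmod (cinner d x (u j)))\<^sup>2) = sqnorm d x"
proof -
  have "complex_of_real (\<Sum>j<d. (cmod (cinner d x (u j)))\<^sup>2) = cinner d x x"
    using parseval[OF assms, of x x] by (simp add: complex_norm_square del: of_real_power)
  then show ?thesis
    by (simp only: cinner_self of_real_eq_iff)
qed

definition qform :: "nat \<Rightarrow> complex mat \<Rightarrow> (nat \<Rightarrow> complex) \<Rightarrow> real" where
  "qform d A x = Re (cinner d (mat_app d A x) x)"

lemma cmod_cinner_commute: "cmod (cinner d x y) = cmod (cinner d y x)"
  by (metis cnj_cinner complex_mod_cnj)

lemma mat_app_add: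
  assumes "A \<in> carrier_mat d d" "B \<in> carrier_mat d d" "k < d"
  shows "mat_app d (A + B) x k = mat_app d A x k + mat_app d B x k"
  using assms by (simp add: mat_app_def sum.distrib algebra_simps)

text \<open>Write \<open>B\<close> as \<open>(A + B) - A\<close> and let each summand act on the
  basis that diagonalizes it. In this way the eigenvalue differences \<open>b j - a i\<close> become
  matrix elements of \<open>B\<close>.\<close>

lemma overlap_perturbation:
  assumes A: "hermitian_mat d A" and B: "hermitian_mat d B" and AB: "hermitian_mat d (A + B)"
    and u: "eigenbasis d A u a" and v: "eigenbasis d (A + B) v b" and ij: "i < d" "j < d"
  shows "cinner d (mat_app d B (u i)) (v j) = (b j - a i) * cinner d (u i) (v j)"
proof -
  have c: "A \<in> carrier_mat d d" "B \<in> carrier_mat d d"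
    using A B by (simp_all add: hermitian_mat_def)
  have "cinner d (mat_app d B (u i)) (v j) =
      cinner d (mat_app d (A + B) (u i)) (v j) - cinner d (mat_app d A (u i)) (v j)"
    by (simp add: cinner_def mat_app_add[OF c] algebra_simps sum_subtractf sum.distrib)
  also have "cinner d (mat_app d (A + B) (u i)) (v j) = cinner d (u i) (\<lambda>k. b j * v j k)"
    using ij by (subst cinner_mat_app_hermitian[OF AB]) (auto intro!: cinner_cong simp: eigenbasis_eigen[OF v])
  also have "cinner d (mat_app d A (u i)) (v j) = cinner d (\<lambda>k. a i * u i k) (v j)"
    using ij by (auto intro!: cinner_cong simp: eigenbasis_eigen[OF u])
  finally show ?thesis
    by (simp add: cinner_scale_left cinner_scale_right algebra_simps)
qed

text \<open>The squared overlaps of the two eigenbases form a doubly stochastic matrix, against which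
  the scalar inequality is averaged.\<close>

theorem klein_second_order:
  assumes A: "hermitian_mat d A" and B: "hermitian_mat d B" and AB: "hermitian_mat d (A + B)"
    and u: "eigenbasis d A u a" and v: "eigenbasis d (A + B) v b"
    and le: "\<And>x y. f y \<le> f x + (y - x) * g x + (y - x)\<^sup>2 * (p y + r x)"
  shows "(\<Sum>j<d. f (b j)) \<le> (\<Sum>i<d. f (a i)) + (\<Sum>i<d. g (a i) * qform d B (u i))
    + (\<Sum>j<d. p (b j) * sqnorm d (mat_app d B (v j)))
    + (\<Sum>i<d. r (a i) * sqnorm d (mat_app d B (u i)))"
proof -
  define w where "w i j = (cmod (cinner d (u i) (v j)))\<^sup>2" for i j
  note pert = overlap_perturbation[OF A B AB u v]
  have row: "(\<Sum>j<d. w i j) = 1" if "i < d" for i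
    using sqnorm_parseval[OF v, of "u i"] that by (simp add: w_def eigenbasis_sqnorm[OF u])
  have col: "(\<Sum>i<d. w i j) = 1" if "j < d" for j
    using sqnorm_parseval[OF u, of "v j"] that
    by (simp add: w_def eigenbasis_sqnorm[OF v] cmod_cinner_commute[of d "u _"])
  have lin: "(\<Sum>j<d. (b j - a i) * w i j) = qform d B (u i)" if i: "i < d" for i
  proof -
    have "cinner d (mat_app d B (u i)) (u i) =
        (\<Sum>j<d. (b j - a i) * (cinner d (u i) (v j) * cnj (cinner d (u i) (v j))))"
      using i unfolding parseval[OF v, of "mat_app d B (u i)" "u i", symmetric]
      by (intro sum.cong) (auto simp: pert)
    also have "\<dots> = of_real (\<Sum>j<d. (b j - a i) * w i j)"
      by (simp add: w_def complex_norm_square[symmetric] del: complex_norm_square)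
    finally show ?thesis
      by (simp add: qform_def)
  qed
  have sq: "(cmod (cinner d (mat_app d B (u i)) (v j)))\<^sup>2 = (b j - a i)\<^sup>2 * w i j" if "i < d" "j < d" for i j
    using that by (simp add: pert w_def norm_mult power_mult_distrib flip: of_real_diff)
  \<comment> \<open>Averaged squares of the increments are squared norms of \<open>B\<close> on an
    eigenvector. The remainder weight \<open>r\<close> sits at \<open>a i\<close> and needs the
    average over a row; \<open>p\<close> sits at \<open>b j\<close> and needs the average over a
    column.\<close>
  have rowsq: "(\<Sum>j<d. (b j - a i)\<^sup>2 * w i j) = sqnorm d (mat_app d B (u i))" if "i < d" for i
    using that by (simp add: sqnorm_parseval[OF v, symmetric] sq)
  have colsq: "(\<Sum>i<d. (b j - a i)\<^sup>2 * w i j) = sqnorm d (mat_app d B (v j))" if "j < d" for j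
    using that unfolding sqnorm_parseval[OF u, symmetric]
    by (intro sum.cong refl)
      (simp add: sq[symmetric] cinner_mat_app_hermitian[OF B, of "v j"] cmod_cinner_commute[of d "v j"])
  have "(\<Sum>j<d. f (b j)) = (\<Sum>j<d. \<Sum>i<d. w i j * f (b j))"
    by (simp add: sum_distrib_right[symmetric] col)
  also have "\<dots> \<le> (\<Sum>j<d. \<Sum>i<d. w i j * (f (a i) + (b j - a i) * g (a i) + (b j - a i)\<^sup>2 * (p (b j) + r (a i))))"
    by (intro sum_mono mult_left_mono le) (simp add: w_def)
  also have "\<dots> = (\<Sum>j<d. \<Sum>i<d. f (a i) * w i j) + (\<Sum>j<d. \<Sum>i<d. g (a i) * ((b j - a i) * w i j))
     + (\<Sum>j<d. \<Sum>i<d. p (b j) * ((b j - a i)\<^sup>2 * w i j)) + (\<Sum>j<d. \<Sum>i<d. r (a i) * ((b j - a i)\<^sup>2 * w i j))"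
    by (simp add: sum.distrib[symmetric] algebra_simps)
  also have "(\<Sum>j<d. \<Sum>i<d. f (a i) * w i j) = (\<Sum>i<d. f (a i))"
    by (subst sum.swap) (simp add: sum_distrib_left[symmetric] row)
  also have "(\<Sum>j<d. \<Sum>i<d. g (a i) * ((b j - a i) * w i j)) = (\<Sum>i<d. g (a i) * qform d B (u i))"
    by (subst sum.swap) (simp add: sum_distrib_left[symmetric] lin)
  also have "(\<Sum>j<d. \<Sum>i<d. p (b j) * ((b j - a i)\<^sup>2 * w i j)) = (\<Sum>j<d. p (b j) * sqnorm d (mat_app d B (v j)))"
    by (simp add: sum_distrib_left[symmetric] colsq)
  also have "(\<Sum>j<d. \<Sum>i<d. r (a i) * ((b j - a i)\<^sup>2 * w i j)) = (\<Sum>i<d. r (a i) * sqnorm d (mat_app d B (u i)))"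
    by (subst sum.swap) (simp add: sum_distrib_left[symmetric] rowsq)
  finally show ?thesis .
qed

text \<open>Unitary invariance of the Frobenius norm: Parseval applied to each conjugated row of
  \<open>B\<close>.\<close>

lemma sum_sqnorm_mat_app:
  assumes "eigenbasis d A u ev"
  shows "(\<Sum>i<d. sqnorm d (mat_app d B (u i))) = (\<Sum>k<d. \<Sum>l<d. (cmod (B $$ (k, l)))\<^sup>2)"
proof -
  have "mat_app d B (u i) k = cnj (cinner d (\<lambda>l. cnj (B $$ (k, l))) (u i))" for i k
    by (simp add: mat_app_def cinner_def)
  then have "(\<Sum>i<d. sqnorm d (mat_app d B (u i))) =
      (\<Sum>k<d. \<Sum>i<d. (cmod (cinner d (\<lambda>l. cnj (B $$ (k, l))) (u i)))\<^sup>2)"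
    unfolding sqnorm_def by (subst sum.swap) simp
  also have "\<dots> = (\<Sum>k<d. \<Sum>l<d. (cmod (B $$ (k, l)))\<^sup>2)"
    by (simp add: sqnorm_parseval[OF assms]) (simp add: sqnorm_def)
  finally show ?thesis .
qed

section \<open>Expectation values and positivity in terms of an eigenbasis\<close>

lemma expect_val_eq:
  assumes "E \<in> carrier_mat d d" "S \<in> carrier_mat d d"
  shows "expect_val E S = Re (\<Sum>k<d. \<Sum>l<d. E $$ (k, l) * S $$ (l, k))"
  using assms by (auto simp: expect_val_def mat_trace_def scalar_prod_def atLeast0LessThan intro!: arg_cong[of _ _ Re] sum.cong)

lemma eigenbasis_expansion:
  assumes u: "eigenbasis d A u ev" and kl: "k < d" "l < d"
  shows "A $$ (k, l) = (\<Sum>i<d. ev i * (u i k * cnj (u i l)))"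
proof -
  have "(\<Sum>i<d. ev i * (u i k * cnj (u i l))) = (\<Sum>i<d. mat_app d A (u i) k * cnj (u i l))"
    using kl by (simp add: eigenbasis_eigen[OF u] mult.assoc)
  also have "\<dots> = (\<Sum>m<d. \<Sum>i<d. A $$ (k, m) * (u i m * cnj (u i l)))"
    unfolding mat_app_def sum_distrib_right by (subst sum.swap) (simp add: mult.assoc)
  also have "\<dots> = (\<Sum>m<d. A $$ (k, m) * (if m = l then 1 else 0))"
    using kl by (simp add: sum_distrib_left[symmetric] eigenbasis_complete[OF u])
  also have "\<dots> = A $$ (k, l)"
    using kl by (simp add: if_distrib cong: if_cong)
  finally show ?thesis by simp
qed

lemma expect_val_eigenbasis:
  assumes A: "A \<in> carrier_mat d d" and S: "S \<in> carrier_mat d d" and u: "eigenbasis d A u ev"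
  shows "expect_val A S = (\<Sum>i<d. ev i * qform d S (u i))"
proof -
  have "(\<Sum>k<d. \<Sum>l<d. A $$ (k, l) * S $$ (l, k)) =
     (\<Sum>k<d. \<Sum>l<d. \<Sum>i<d. ev i * (u i k * cnj (u i l)) * S $$ (l, k))"
    by (simp add: eigenbasis_expansion[OF u] sum_distrib_right)
  also have "\<dots> = (\<Sum>k<d. \<Sum>i<d. \<Sum>l<d. ev i * (u i k * cnj (u i l)) * S $$ (l, k))"
    by (intro sum.cong refl sum.swap)
  also have "\<dots> = (\<Sum>i<d. \<Sum>k<d. \<Sum>l<d. ev i * (u i k * cnj (u i l)) * S $$ (l, k))"
    by (rule sum.swap)
  also have "\<dots> = (\<Sum>i<d. \<Sum>l<d. \<Sum>k<d. ev i * (u i k * cnj (u i l)) * S $$ (l, k))"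
    by (intro sum.cong refl sum.swap)
  also have "\<dots> = (\<Sum>i<d. ev i * cinner d (mat_app d S (u i)) (u i))"
    by (simp add: cinner_def mat_app_def sum_distrib_left sum_distrib_right algebra_simps)
  finally show ?thesis
    by (simp add: expect_val_eq[OF A S] qform_def)
qed

lemma expect_val_commute:
  assumes "E \<in> carrier_mat d d" "S \<in> carrier_mat d d"
  shows "expect_val E S = expect_val S E"
  unfolding expect_val_def by (simp add: mat_trace_mult_commute[OF assms])

lemma cinner_mat_app_eq:
  assumes "A \<in> carrier_mat d d"
  shows "cinner d (mat_app d A x) x = (A *\<^sub>v vec d x) \<bullet>c vec d x"
  using assms by (auto simp: cinner_def mat_app_def scalar_prod_def atLeast0LessThan intro!: sum.cong)

text \<open>For Hermitian \<open>A\<close> the form is real, so the complex order only compares real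
  parts; carrier vectors are exactly the functions cut off at \<open>d\<close>.\<close>

lemma psd_mat_iff:
  "psd_mat d A \<longleftrightarrow> hermitian_mat d A \<and> (\<forall>x. 0 \<le> qform d A x)"
proof (cases "hermitian_mat d A")
  case True
  then have A: "A \<in> carrier_mat d d"
    by (simp add: hermitian_mat_def)
  have real: "cinner d (mat_app d A x) x = of_real (qform d A x)" for x
  proof -
    have "cnj (cinner d (mat_app d A x) x) = cinner d (mat_app d A x) x"
      by (simp add: cnj_cinner cinner_mat_app_hermitian[OF True])
    then show ?thesis
      unfolding qform_def by (metis Reals_cnj_iff of_real_Re)
  qed
  have "(\<forall>v\<in>carrier_vec d. 0 \<le> (A *\<^sub>v v) \<bullet>c v) \<longleftrightarrow> (\<forall>x. 0 \<le> (A *\<^sub>v vec d x) \<bullet>c vec d x)"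
    by (metis vec_carrier eq_vecI carrier_vecD dim_vec index_vec)
  also have "\<dots> \<longleftrightarrow> (\<forall>x. 0 \<le> qform d A x)"
    unfolding cinner_mat_app_eq[OF A, symmetric] real by (simp add: less_eq_complex_def)
  finally show ?thesis
    using True by (simp add: psd_mat_def)
qed (simp add: psd_mat_def)

section \<open>States and effects\<close>

lemma cinner_mat_app_eigenvector:
  assumes A: "hermitian_mat d A" and u: "eigenbasis d A u ev" and "i < d"
  shows "cinner d (mat_app d A x) (u i) = ev i * cinner d x (u i)"
proof -
  have "cinner d (mat_app d A x) (u i) = cinner d x (\<lambda>k. ev i * u i k)"
    unfolding cinner_mat_app_hermitian[OF A]
    using \<open>i < d\<close> by (intro cinner_cong) (auto simp: eigenbasis_eigen[OF u])
  then show ?thesis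
    by (simp add: cinner_scale_right)
qed

lemma qform_eigenbasis:
  assumes A: "hermitian_mat d A" and u: "eigenbasis d A u ev"
  shows "qform d A x = (\<Sum>i<d. ev i * (cmod (cinner d x (u i)))\<^sup>2)"
proof -
  have "cinner d (mat_app d A x) x = (\<Sum>i<d. cinner d (mat_app d A x) (u i) * cnj (cinner d x (u i)))"
    by (rule parseval[OF u, symmetric])
  also have "\<dots> = (\<Sum>i<d. of_real (ev i * (cmod (cinner d x (u i)))\<^sup>2))"
    by (intro sum.cong refl)
      (simp add: cinner_mat_app_eigenvector[OF A u] complex_norm_square del: of_real_power)
  finally show ?thesis
    by (simp add: qform_def)
qed

lemma sqnorm_mat_app_eigenbasis:
  assumes A: "hermitian_mat d A" and u: "eigenbasis d A u ev"
  shows "sqnorm d (mat_app d A x) = (\<Sum>i<d. (ev i)\<^sup>2 * (cmod (cinner d x (u i)))\<^sup>2)"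
  unfolding sqnorm_parseval[OF u, symmetric]
  by (intro sum.cong refl) (simp add: cinner_mat_app_eigenvector[OF A u] norm_mult power_mult_distrib)

lemma qform_eigenvector:
  assumes u: "eigenbasis d A u ev" and "i < d"
  shows "qform d A (u i) = ev i"
proof -
  have "cinner d (mat_app d A (u i)) (u i) = cinner d (\<lambda>k. ev i * u i k) (u i)"
    using \<open>i < d\<close> by (intro cinner_cong) (auto simp: eigenbasis_eigen[OF u])
  then show ?thesis
    using \<open>i < d\<close> by (simp add: qform_def cinner_scale_left eigenbasis_orthonormal[OF u])
qed

lemma sum_qform_eigenbasis:
  assumes S: "S \<in> carrier_mat d d" and u: "eigenbasis d A u ev"
  shows "(\<Sum>i<d. qform d S (u i)) = Re (mat_trace S)"
proof -
  \<comment> \<open>Every orthonormal basis diagonalizes the identity with all eigenvalues 1, so the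
    formula for expectation values specializes to the trace.\<close>
  have one: "eigenbasis d (1\<^sub>m d) u (\<lambda>_. 1)"
    using u by (simp add: eigenbasis_def mat_app_def if_distrib[of "\<lambda>z. z * _"] cong: if_cong)
  have "expect_val (1\<^sub>m d) S = Re (mat_trace S)"
    using S by (simp add: expect_val_def)
  then show ?thesis
    using expect_val_eigenbasis[OF one_carrier_mat S one] by simp
qed

lemma qform_one_minus:
  assumes "E \<in> carrier_mat d d"
  shows "qform d (1\<^sub>m d - E) x = sqnorm d x - qform d E x"
proof -
  have "mat_app d (1\<^sub>m d - E) x k = x k - mat_app d E x k" if "k < d" for k
    using assms that
    by (simp add: mat_app_def left_diff_distrib sum_subtractf if_distrib[of "\<lambda>z. z * _"] cong: if_cong)
  then have "cinner d (mat_app d (1\<^sub>m d - E) x) x = cinner d x x - cinner d (mat_app d E x) x"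
    by (simp add: cinner_def left_diff_distrib sum_subtractf)
  then show ?thesis
    by (simp add: qform_def cinner_self)
qed

lemma effect_hermitian: "E \<in> effects n \<Longrightarrow> hermitian_mat (2 ^ n) E"
  by (simp add: effects_def)

lemma effect_carrier: "E \<in> effects n \<Longrightarrow> E \<in> carrier_mat (2 ^ n) (2 ^ n)"
  by (simp add: effects_def hermitian_mat_def)

lemma state_carrier: "\<sigma> \<in> quantum_states n \<Longrightarrow> \<sigma> \<in> carrier_mat (2 ^ n) (2 ^ n)"
  by (simp add: quantum_states_def psd_mat_def hermitian_mat_def)

text \<open>In an eigenbasis of \<open>E\<close> all eigenvalues lie between 0 and 1, so no
  coefficient grows. This serves the exponential potential as an operator norm bound and the square
  potential as a bound on entries.\<close>

lemma effect_contraction: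
  assumes "E \<in> effects n"
  shows "sqnorm (2 ^ n) (mat_app (2 ^ n) E x) \<le> sqnorm (2 ^ n) x"
proof -
  let ?d = "2 ^ n :: nat"
  have E: "hermitian_mat ?d E" and E0: "\<And>x. 0 \<le> qform ?d E x" and E1: "\<And>x. 0 \<le> qform ?d (1\<^sub>m ?d - E) x"
    using assms by (simp_all add: effects_def psd_mat_iff)
  note Ec = effect_carrier[OF assms]
  obtain u ev where u: "eigenbasis ?d E u ev"
    using hermitian_eigenbasis[OF E] by blast
  have "(ev i)\<^sup>2 \<le> 1" if "i < ?d" for i
    using E0[of "u i"] E1[of "u i"] that
    by (simp add: qform_one_minus[OF Ec] qform_eigenvector[OF u] eigenbasis_sqnorm[OF u] abs_square_le_1)
  then have "(\<Sum>i<?d. (ev i)\<^sup>2 * (cmod (cinner ?d x (u i)))\<^sup>2) \<le> (\<Sum>i<?d. (cmod (cinner ?d x (u i)))\<^sup>2)"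
    by (intro sum_mono) (simp add: mult_left_le_one_le)
  then show ?thesis
    by (simp add: sqnorm_mat_app_eigenbasis[OF E u] sqnorm_parseval[OF u])
qed

text \<open>The entry is a coordinate of the image of a standard basis vector, and \<open>E\<close>
  is a contraction.\<close>

lemma effect_entry_le_1:
  assumes "E \<in> effects n" and kl: "k < 2 ^ n" "l < 2 ^ n"
  shows "(cmod (E $$ (k, l)))\<^sup>2 \<le> 1"
proof -
  define x where "x m = (if m = l then 1 else 0 :: complex)" for m
  have "mat_app (2 ^ n) E x k = E $$ (k, l)"
    using kl by (simp add: mat_app_def x_def if_distrib cong: if_cong)
  then have "(cmod (E $$ (k, l)))\<^sup>2 \<le> sqnorm (2 ^ n) (mat_app (2 ^ n) E x)"
    unfolding sqnorm_def using kl member_le_sum[of k "{..<2 ^ n}" "\<lambda>k. (cmod (mat_app (2 ^ n) E x k))\<^sup>2"]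
    by simp
  also have "\<dots> \<le> sqnorm (2 ^ n) x"
    by (rule effect_contraction[OF assms(1)])
  also have "\<dots> = 1"
    using kl by (simp add: sqnorm_def x_def if_distrib[of "\<lambda>z. (cmod z)\<^sup>2"] cong: if_cong)
  finally show ?thesis .
qed

lemma sparse_effect_frobenius:
  assumes E: "E \<in> effects n" and sp: "sparse_mat \<kappa> E"
  shows "(\<Sum>k<2 ^ n. \<Sum>l<2 ^ n. (cmod (E $$ (k, l)))\<^sup>2) \<le> real \<kappa>"
proof -
  let ?I = "{(i, j). i < dim_row E \<and> j < dim_col E \<and> E $$ (i, j) \<noteq> 0}"
  have dims: "dim_row E = 2 ^ n" "dim_col E = 2 ^ n"
    using effect_hermitian[OF E] by (auto simp: hermitian_mat_def)
  have sub: "?I \<subseteq> {..<2 ^ n} \<times> {..<2 ^ n}"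
    by (auto simp: dims)
  have "(\<Sum>k<2 ^ n. \<Sum>l<2 ^ n. (cmod (E $$ (k, l)))\<^sup>2) = (\<Sum>z\<in>{..<2 ^ n} \<times> {..<2 ^ n}. (cmod (E $$ z))\<^sup>2)"
    by (simp add: sum.cartesian_product case_prod_unfold)
  also have "\<dots> = (\<Sum>z\<in>?I. (cmod (E $$ z))\<^sup>2)"
    by (rule sum.mono_neutral_right) (use sub dims in auto)
  also have "\<dots> \<le> (\<Sum>z\<in>?I. 1)"
    by (intro sum_mono) (auto simp: dims intro!: effect_entry_le_1[OF E])
  also have "\<dots> \<le> real \<kappa>"
    using sp by (simp add: sparse_mat_def)
  finally show ?thesis .
qed

section \<open>Functions of a Hermitian matrix and linear combinations\<close>

definition spectral_mat :: "nat \<Rightarrow> (nat \<Rightarrow> nat \<Rightarrow> complex) \<Rightarrow> (nat \<Rightarrow> real) \<Rightarrow> complex mat" where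
  "spectral_mat d u p = mat d d (\<lambda>(k, l). \<Sum>i<d. p i * (u i k * cnj (u i l)))"

lemma spectral_mat_carrier [simp]: "spectral_mat d u p \<in> carrier_mat d d"
  by (simp add: spectral_mat_def)

lemma hermitian_spectral_mat: "hermitian_mat d (spectral_mat d u p)"
  by (simp add: hermitian_mat_iff spectral_mat_def mult.commute)

lemma eigenbasis_spectral_mat:
  assumes u: "eigenbasis d A u ev"
  shows "eigenbasis d (spectral_mat d u p) u p"
proof -
  have "mat_app d (spectral_mat d u p) (u j) k = p j * u j k" if "j < d" "k < d" for j k
  proof -
    have "mat_app d (spectral_mat d u p) (u j) k = (\<Sum>l<d. \<Sum>i<d. p i * u i k * (u j l * cnj (u i l)))"
      using that by (simp add: mat_app_def spectral_mat_def sum_distrib_right sum_distrib_left algebra_simps)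
    also have "\<dots> = (\<Sum>i<d. p i * u i k * cinner d (u j) (u i))"
      by (subst sum.swap) (simp add: cinner_def sum_distrib_left)
    also have "\<dots> = (\<Sum>i<d. p i * u i k * (if j = i then 1 else 0))"
      using that by (intro sum.cong) (auto simp: eigenbasis_orthonormal[OF u])
    also have "\<dots> = p j * u j k"
      using that by (simp add: if_distrib cong: if_cong)
    finally show ?thesis .
  qed
  then show ?thesis
    using u by (simp add: eigenbasis_def)
qed

lemma spectral_mat_state:
  assumes u: "eigenbasis (2 ^ n) A u ev" and p: "\<And>i. 0 \<le> p i" "(\<Sum>i<2 ^ n. p i) = 1"
  shows "spectral_mat (2 ^ n) u p \<in> quantum_states n"
proof -
  let ?d = "2 ^ n :: nat" and ?S = "spectral_mat (2 ^ n) u p"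
  note S = eigenbasis_spectral_mat[OF u, of p]
  have "mat_trace ?S = (\<Sum>k<?d. \<Sum>i<?d. p i * (u i k * cnj (u i k)))"
    by (simp add: mat_trace_def spectral_mat_def)
  also have "\<dots> = (\<Sum>i<?d. p i * cinner ?d (u i) (u i))"
    by (subst sum.swap) (simp add: cinner_def sum_distrib_left)
  also have "\<dots> = (\<Sum>i<?d. of_real (p i))"
    by (intro sum.cong) (auto simp: eigenbasis_orthonormal[OF u])
  also have "\<dots> = 1"
    by (simp flip: of_real_sum add: p)
  finally have "mat_trace ?S = 1" .
  moreover have "0 \<le> qform ?d ?S x" for x
    unfolding qform_eigenbasis[OF hermitian_spectral_mat S] by (intro sum_nonneg mult_nonneg_nonneg) (simp_all add: p)
  ultimately show ?thesis
    by (simp add: quantum_states_def psd_mat_iff hermitian_spectral_mat)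
qed

lemma expect_val_spectral_mat:
  assumes "E \<in> carrier_mat d d" and u: "eigenbasis d A u ev"
  shows "expect_val E (spectral_mat d u p) = (\<Sum>i<d. p i * qform d E (u i))"
  using expect_val_eigenbasis[OF spectral_mat_carrier assms(1) eigenbasis_spectral_mat[OF u]]
    expect_val_commute[OF assms(1) spectral_mat_carrier] by simp

lemma hermitian_zero: "hermitian_mat d (0\<^sub>m d d)"
  by (simp add: hermitian_mat_iff)

lemma hermitian_add_smult:
  assumes "hermitian_mat d A" "hermitian_mat d B"
  shows "hermitian_mat d (A + complex_of_real c \<cdot>\<^sub>m B)"
proof -
  have c: "A \<in> carrier_mat d d" "B \<in> carrier_mat d d"
    using assms by (simp_all add: hermitian_mat_def)
  have "(A + complex_of_real c \<cdot>\<^sub>m B) $$ (l, k) = cnj ((A + complex_of_real c \<cdot>\<^sub>m B) $$ (k, l))"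
    if "k < d" "l < d" for k l
  proof -
    have "(A + complex_of_real c \<cdot>\<^sub>m B) $$ (l, k) = A $$ (l, k) + c * B $$ (l, k)"
      using c that by simp
    also have "\<dots> = cnj (A $$ (k, l) + c * B $$ (k, l))"
      by (subst hermitian_mat_entry[OF assms(1) that], subst hermitian_mat_entry[OF assms(2) that]) simp
    also have "A $$ (k, l) + c * B $$ (k, l) = (A + complex_of_real c \<cdot>\<^sub>m B) $$ (k, l)"
      using c that by simp
    finally show ?thesis .
  qed
  then show ?thesis
    unfolding hermitian_mat_iff using c by (intro conjI allI impI) auto
qed

lemma hermitian_smult:
  assumes "hermitian_mat d B"
  shows "hermitian_mat d (complex_of_real c \<cdot>\<^sub>m B)"
proof -
  have "0\<^sub>m d d + complex_of_real c \<cdot>\<^sub>m B = complex_of_real c \<cdot>\<^sub>m B"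
    using assms by (intro left_add_zero_mat) (simp add: hermitian_mat_def)
  then show ?thesis
    using hermitian_add_smult[OF hermitian_zero assms, of c] by argo
qed

lemma expect_val_add_smult:
  assumes "A \<in> carrier_mat d d" "B \<in> carrier_mat d d" "S \<in> carrier_mat d d"
  shows "expect_val (A + complex_of_real c \<cdot>\<^sub>m B) S = expect_val A S + c * expect_val B S"
proof -
  have "expect_val (A + complex_of_real c \<cdot>\<^sub>m B) S =
      Re (\<Sum>k<d. \<Sum>l<d. (A + complex_of_real c \<cdot>\<^sub>m B) $$ (k, l) * S $$ (l, k))"
    using assms by (intro expect_val_eq) auto
  also have "\<dots> = Re ((\<Sum>k<d. \<Sum>l<d. A $$ (k, l) * S $$ (l, k)) + of_real c * (\<Sum>k<d. \<Sum>l<d. B $$ (k, l) * S $$ (l, k)))"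
    using assms by (simp add: algebra_simps sum.distrib sum_distrib_left)
  finally show ?thesis
    by (simp add: expect_val_eq[OF assms(1,3)] expect_val_eq[OF assms(2,3)])
qed

lemma expect_val_smult:
  assumes "B \<in> carrier_mat d d" "S \<in> carrier_mat d d"
  shows "expect_val (complex_of_real c \<cdot>\<^sub>m B) S = c * expect_val B S"
proof -
  have "0\<^sub>m d d + complex_of_real c \<cdot>\<^sub>m B = complex_of_real c \<cdot>\<^sub>m B"
    using assms by (intro left_add_zero_mat) simp
  moreover have "expect_val (0\<^sub>m d d) S = 0"
    by (simp add: expect_val_eq[OF zero_carrier_mat assms(2)])
  ultimately show ?thesis
    using expect_val_add_smult[OF zero_carrier_mat assms, of c] by simp
qed

lemma sqnorm_mat_app_smult:
  assumes "B \<in> carrier_mat d d"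
  shows "sqnorm d (mat_app d (complex_of_real c \<cdot>\<^sub>m B) x) = c\<^sup>2 * sqnorm d (mat_app d B x)"
proof -
  have "mat_app d (complex_of_real c \<cdot>\<^sub>m B) x k = c * mat_app d B x k" if "k < d" for k
    using assms that by (simp add: mat_app_def sum_distrib_left mult.assoc)
  then show ?thesis
    by (simp add: sqnorm_def norm_mult power_mult_distrib sum_distrib_left)
qed

section \<open>Potentials and regret\<close>

text \<open>\<open>g\<close> is a subgradient of the convex \<open>f\<close>. \<open>fenchel\<close>
  says that the convex conjugate of \<open>f\<close> at \<open>s\<close> is at most
  \<open>c * s\<close> on the unit interval, hence adds up to at most \<open>c\<close> over a
  probability vector; \<open>start\<close> bounds the potential at the zero matrix. Continuity,
  \<open>g_small\<close> and \<open>g_large\<close> provide the shift that normalizes the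
  trace.\<close>

locale spectral_potential =
  fixes d :: nat and f g :: "real \<Rightarrow> real" and K c :: real
  assumes d_pos: "0 < d"
    and subgradient: "f x + (y - x) * g x \<le> f y"
    and g_nonneg: "0 \<le> g x"
    and g_continuous: "continuous_on UNIV g"
    and g_small: "\<exists>y. \<forall>x\<le>y. real d * g x \<le> 1"
    and g_large: "\<exists>x. 1 \<le> g x"
    and fenchel: "0 \<le> s \<Longrightarrow> s \<le> 1 \<Longrightarrow> x * s \<le> f x + c * s"
    and start: "\<exists>\<tau>. \<tau> + real d * f (- \<tau>) \<le> K"
begin

lemma ex_normalizer: "\<exists>\<tau>. (\<Sum>i<d. g (a i - \<tau>)) = 1"
proof -
  define h where "h \<tau> = (\<Sum>i<d. g (a i - \<tau>))" for \<tau>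
  obtain y where y: "\<And>x. x \<le> y \<Longrightarrow> real d * g x \<le> 1"
    using g_small by auto
  obtain z where z: "1 \<le> g z"
    using g_large by auto
  \<comment> \<open>At \<open>t0\<close> the term with index 0 alone reaches 1; at \<open>t1\<close>
    every argument is at most \<open>y\<close>, so each of the \<open>d\<close> terms is at most
    \<open>1 / d\<close>. The maximum with \<open>t0\<close> keeps the interval nonempty for the
    intermediate value theorem.\<close>
  define t0 where "t0 = a 0 - z"
  define t1 where "t1 = max t0 (Max (a ` {..<d}) - y)"
  have "1 \<le> g (a 0 - t0)"
    by (simp add: t0_def z)
  also have "\<dots> \<le> h t0"
    unfolding h_def using d_pos g_nonneg by (intro member_le_sum[where f = "\<lambda>i. g (a i - t0)"]) auto
  finally have "1 \<le> h t0" .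
  moreover have "h t1 \<le> 1"
  proof -
    have "a i - t1 \<le> y" if "i < d" for i
    proof -
      have "a i \<le> Max (a ` {..<d})"
        using that by simp
      moreover have "Max (a ` {..<d}) - y \<le> t1"
        by (simp add: t1_def)
      ultimately show ?thesis
        by linarith
    qed
    then have "g (a i - t1) \<le> 1 / real d" if "i < d" for i
      using y[of "a i - t1"] that d_pos by (simp add: field_simps)
    then have "h t1 \<le> (\<Sum>i<d. 1 / real d)"
      unfolding h_def by (intro sum_mono) auto
    then show ?thesis
      using d_pos by simp
  qed
  moreover have "continuous_on {t0..t1} h"
    unfolding h_def
    by (intro continuous_on_sum continuous_on_compose2[OF g_continuous] continuous_intros) auto
  ultimately have "\<exists>\<tau>. t0 \<le> \<tau> \<and> \<tau> \<le> t1 \<and> h \<tau> = 1"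
    by (intro IVT2') (auto simp: t1_def)
  then show ?thesis
    by (auto simp: h_def)
qed

text \<open>\<open>pot\<close> and \<open>response\<close> unpack the same chosen triple, so their
  eigenbases and shifts agree.\<close>

definition normalized :: "complex mat \<Rightarrow> (nat \<Rightarrow> nat \<Rightarrow> complex) \<times> (nat \<Rightarrow> real) \<times> real \<Rightarrow> bool" where
  "normalized A = (\<lambda>(u, a, \<tau>). eigenbasis d A u a \<and> (\<Sum>i<d. g (a i - \<tau>)) = 1)"

text \<open>The potential is the minimum over \<open>\<tau>\<close> of \<open>\<tau> + tr f (A - \<tau>)\<close>, and the response its gradient.\<close>

definition pot :: "complex mat \<Rightarrow> real" where
  "pot A = (case SOME z. normalized A z of (u, a, \<tau>) \<Rightarrow> \<tau> + (\<Sum>i<d. f (a i - \<tau>)))"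

definition response :: "complex mat \<Rightarrow> complex mat" where
  "response A = (case SOME z. normalized A z of (u, a, \<tau>) \<Rightarrow> spectral_mat d u (\<lambda>i. g (a i - \<tau>)))"

lemma normalizedE:
  assumes "hermitian_mat d A"
  obtains u a \<tau> where "eigenbasis d A u a" "(\<Sum>i<d. g (a i - \<tau>)) = 1"
    "pot A = \<tau> + (\<Sum>i<d. f (a i - \<tau>))" "response A = spectral_mat d u (\<lambda>i. g (a i - \<tau>))"
proof -
  obtain u a where u: "eigenbasis d A u a"
    using hermitian_eigenbasis[OF assms] by blast
  obtain \<tau> where "(\<Sum>i<d. g (a i - \<tau>)) = 1"
    using ex_normalizer by blast
  with u have "normalized A (u, a, \<tau>)"
    by (simp add: normalized_def)
  then have *: "normalized A (SOME z. normalized A z)"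
    by (rule someI)
  show thesis
    using * that
    by (cases "SOME z. normalized A z") (auto simp: pot_def response_def normalized_def)
qed

text \<open>The right-hand side is convex in \<open>\<sigma>\<close> with slope
  \<open>1 - (\<Sum>i<d. g (a i - \<sigma>))\<close>, which vanishes at
  \<open>\<tau>\<close>.\<close>

lemma normalizer_minimizes:
  assumes "(\<Sum>i<d. g (a i - \<tau>)) = 1"
  shows "\<tau> + (\<Sum>i<d. f (a i - \<tau>)) \<le> \<sigma> + (\<Sum>i<d. f (a i - \<sigma>))"
proof -
  have "(\<Sum>i<d. f (a i - \<tau>)) + (\<tau> - \<sigma>) * (\<Sum>i<d. g (a i - \<tau>)) \<le> (\<Sum>i<d. f (a i - \<sigma>))"
    unfolding sum_distrib_left sum.distrib[symmetric]
  proof (rule sum_mono)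
    fix i
    show "f (a i - \<tau>) + (\<tau> - \<sigma>) * g (a i - \<tau>) \<le> f (a i - \<sigma>)"
      using subgradient[of "a i - \<tau>" "a i - \<sigma>"] by simp
  qed
  then show ?thesis
    by (simp add: assms)
qed

lemma pot_zero_le: "pot (0\<^sub>m d d) \<le> K"
proof -
  obtain u a \<tau> where u: "eigenbasis d (0\<^sub>m d d) u a" "(\<Sum>i<d. g (a i - \<tau>)) = 1"
    "pot (0\<^sub>m d d) = \<tau> + (\<Sum>i<d. f (a i - \<tau>))"
    using normalizedE[OF hermitian_zero] by metis
  have "a i = 0" if "i < d" for i
    using qform_eigenvector[OF u(1) that] by (simp add: qform_def cinner_def mat_app_def)
  moreover obtain \<sigma> where "\<sigma> + real d * f (- \<sigma>) \<le> K"
    using start by blast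
  ultimately show ?thesis
    using normalizer_minimizes[OF u(2), of \<sigma>] u(3) by simp
qed

text \<open>The shift that is optimal for \<open>A\<close> is still admissible for
  \<open>A + B\<close>, so a Klein inequality at this common shift suffices; its linear term is the
  expectation of \<open>B\<close> in the response. \<open>klein\<close> ranges over all eigenbases
  because those inside \<open>pot\<close> are unspecified.\<close>

lemma pot_step:
  assumes A: "hermitian_mat d A" and B: "hermitian_mat d B" and AB: "hermitian_mat d (A + B)"
    and klein: "\<And>u a v b \<tau>. eigenbasis d A u a \<Longrightarrow> eigenbasis d (A + B) v b \<Longrightarrow> (\<Sum>i<d. g (a i - \<tau>)) = 1 \<Longrightarrow>
      (\<Sum>j<d. f (b j - \<tau>)) \<le> (\<Sum>i<d. f (a i - \<tau>)) + (\<Sum>i<d. g (a i - \<tau>) * qform d B (u i)) + q"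
  shows "pot (A + B) \<le> pot A + expect_val B (response A) + q"
proof -
  obtain u a \<tau> where u: "eigenbasis d A u a" "(\<Sum>i<d. g (a i - \<tau>)) = 1"
    "pot A = \<tau> + (\<Sum>i<d. f (a i - \<tau>))" "response A = spectral_mat d u (\<lambda>i. g (a i - \<tau>))"
    using normalizedE[OF A] by metis
  obtain v b \<sigma> where v: "eigenbasis d (A + B) v b" "(\<Sum>i<d. g (b i - \<sigma>)) = 1"
    "pot (A + B) = \<sigma> + (\<Sum>i<d. f (b i - \<sigma>))"
    using normalizedE[OF AB] by metis
  have "pot (A + B) \<le> \<tau> + (\<Sum>j<d. f (b j - \<tau>))"
    unfolding v(3) by (rule normalizer_minimizes[OF v(2)])
  also have "\<dots> \<le> pot A + (\<Sum>i<d. g (a i - \<tau>) * qform d B (u i)) + q"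
    using klein[OF u(1) v(1) u(2)] by (simp add: u(3))
  also have "(\<Sum>i<d. g (a i - \<tau>) * qform d B (u i)) = expect_val B (response A)"
    unfolding u(4) using B by (simp add: expect_val_spectral_mat[OF _ u(1)] hermitian_mat_def)
  finally show ?thesis .
qed

text \<open>Fenchel-Young on the spectrum: the diagonal of \<open>S\<close> in the eigenbasis of
  \<open>A\<close> is a probability vector, so the shift \<open>\<tau>\<close> passes through and
  the conjugate terms add up to \<open>c\<close>.\<close>

lemma expect_val_le_pot:
  assumes A: "hermitian_mat d A" and S: "psd_mat d S" "mat_trace S = 1"
  shows "expect_val A S \<le> pot A + c"
proof -
  obtain u a \<tau> where u: "eigenbasis d A u a" "(\<Sum>i<d. g (a i - \<tau>)) = 1"
    "pot A = \<tau> + (\<Sum>i<d. f (a i - \<tau>))"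
    using normalizedE[OF A] by metis
  have c: "A \<in> carrier_mat d d" "S \<in> carrier_mat d d"
    using A S by (simp_all add: hermitian_mat_def psd_mat_def)
  define s where "s i = qform d S (u i)" for i
  have s0: "0 \<le> s i" for i
    using S by (simp add: s_def psd_mat_iff)
  have s1: "(\<Sum>i<d. s i) = 1"
    using sum_qform_eigenbasis[OF c(2) u(1)] S by (simp add: s_def)
  have sle: "s i \<le> 1" if "i < d" for i
    using member_le_sum[of i "{..<d}" s] s0 that by (simp add: s1)
  have "expect_val A S = (\<Sum>i<d. a i * s i)"
    by (simp add: expect_val_eigenbasis[OF c u(1)] s_def)
  also have "\<dots> = (\<Sum>i<d. (a i - \<tau>) * s i) + \<tau> * (\<Sum>i<d. s i)"
    by (simp add: algebra_simps sum.distrib sum_subtractf sum_distrib_left)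
  also have "\<dots> \<le> (\<Sum>i<d. f (a i - \<tau>) + c * s i) + \<tau> * (\<Sum>i<d. s i)"
    by (intro add_mono sum_mono fenchel) (auto simp: s0 sle)
  also have "\<dots> = pot A + c"
    by (simp add: sum.distrib sum_distrib_left[symmetric] s1 u(3))
  finally show ?thesis .
qed

lemma response_state:
  assumes "d = 2 ^ n" "hermitian_mat d A"
  shows "response A \<in> quantum_states n"
proof -
  obtain u a \<tau> where "eigenbasis d A u a" "(\<Sum>i<d. g (a i - \<tau>)) = 1"
    "response A = spectral_mat d u (\<lambda>i. g (a i - \<tau>))"
    using normalizedE[OF assms(2)] by metis
  then show ?thesis
    using assms(1) spectral_mat_state g_nonneg by simp
qed

end

section \<open>Linearized losses and dual averaging\<close>

text \<open>The bound is separate from existence because the learner takes an unspecified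
  subgradient.\<close>

lemma convex_lipschitz_subgradient:
  fixes l :: "real \<Rightarrow> real"
  assumes cv: "convex_on UNIV l" and lip: "L-lipschitz_on UNIV l"
  shows "\<exists>c. \<forall>y. l x + c * (y - x) \<le> l y"
    and "(\<forall>y. l x + c * (y - x) \<le> l y) \<Longrightarrow> \<bar>c\<bar> \<le> L"
proof -
  show "\<exists>c. \<forall>y. l x + c * (y - x) \<le> l y"
    using convex_le_Inf_differential[OF cv] by (intro exI allI) auto
  assume c: "\<forall>y. l x + c * (y - x) \<le> l y"
  \<comment> \<open>Unit steps to the right and to the left bound \<open>c\<close> from above and
    from below.\<close>
  have "\<bar>l (x + 1) - l x\<bar> \<le> L" "\<bar>l (x - 1) - l x\<bar> \<le> L"
    using lipschitz_onD[OF lip, of "x + 1" x] lipschitz_onD[OF lip, of "x - 1" x]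
    by (simp_all add: dist_real_def)
  then show "\<bar>c\<bar> \<le> L"
    using c[rule_format, of "x + 1"] c[rule_format, of "x - 1"] by (simp add: abs_le_iff)
qed

lemma regret_le:
  assumes "quantum_states n \<noteq> {}"
    and "\<And>\<sigma>. \<sigma> \<in> quantum_states n \<Longrightarrow>
      (\<Sum>(\<omega>, E, l)\<leftarrow>h. l (expect_val E \<omega>)) - (\<Sum>(\<omega>, E, l)\<leftarrow>h. l (expect_val E \<sigma>)) \<le> R"
  shows "regret n h \<le> R"
proof -
  have "(\<Sum>(\<omega>, E, l)\<leftarrow>h. l (expect_val E \<omega>)) - R \<le>
      (INF \<sigma>\<in>quantum_states n. \<Sum>(\<omega>, E, l)\<leftarrow>h. l (expect_val E \<sigma>))"
    by (rule cINF_greatest[OF assms(1)]) (use assms(2) in \<open>simp add: algebra_simps\<close>)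
  then show ?thesis
    by (simp add: regret_def)
qed

abbreviation (input) legal :: "nat \<Rightarrow> nat \<Rightarrow> real \<Rightarrow> transcript \<Rightarrow> bool" where
  "legal n \<kappa> L h \<equiv> \<forall>(\<omega>, E, l)\<in>set h.
     E \<in> effects n \<and> sparse_mat \<kappa> E \<and> convex_on UNIV l \<and> L-lipschitz_on UNIV l"

text \<open>Telescoping: \<open>\<eta>\<close> times the regret against \<open>\<sigma>\<close>,
  plus \<open>V\<close> minus the expectation in \<open>\<sigma>\<close>, both at the accumulated
  matrix, starts at most at \<open>K\<close> and grows by at most \<open>q\<close> per round; by
  \<open>dual\<close> the added difference is at least \<open>- c0\<close>. \<open>W\<close> and
  \<open>V\<close> are abstract so that both potentials fit.\<close>

lemma dual_averaging_regret:
  fixes W :: "complex mat \<Rightarrow> complex mat" and V :: "complex mat \<Rightarrow> real"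
  assumes eta: "0 < \<eta>"
    and W: "\<And>A. hermitian_mat (2 ^ n) A \<Longrightarrow> W A \<in> quantum_states n"
    and V0: "V (0\<^sub>m (2 ^ n) (2 ^ n)) \<le> K"
    and V_step: "\<And>A E c. hermitian_mat (2 ^ n) A \<Longrightarrow> E \<in> effects n \<Longrightarrow> sparse_mat \<kappa> E \<Longrightarrow> \<bar>c\<bar> \<le> \<eta> * L \<Longrightarrow>
      V (A + complex_of_real c \<cdot>\<^sub>m E) \<le> V A + c * expect_val E (W A) + q"
    and dual: "\<And>A \<sigma>. hermitian_mat (2 ^ n) A \<Longrightarrow> \<sigma> \<in> quantum_states n \<Longrightarrow> expect_val A \<sigma> \<le> V A + c0"
  shows "\<exists>A::learner. (\<forall>h. A h \<in> quantum_states n) \<and>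
    (\<forall>B. legal n \<kappa> L (play A B T) \<longrightarrow> regret n (play A B T) \<le> (K + c0 + real T * q) / \<eta>)"
proof -
  define slope where "slope l x = (SOME c. \<forall>y. l x + c * (y - x) \<le> l y)" for l :: "real \<Rightarrow> real" and x :: real
  \<comment> \<open>A revealed matrix that is not an effect is ignored, so the accumulated matrix
    stays Hermitian and the learner outputs a state on every history, legal or not.\<close>
  define upd where "upd A m = (case m of (E, l) \<Rightarrow>
      if E \<in> effects n then A + complex_of_real (- \<eta> * slope l (expect_val E (W A))) \<cdot>\<^sub>m E else A)" for A m
  define \<theta> where "\<theta> = foldl upd (0\<^sub>m (2 ^ n) (2 ^ n))"
  have herm: "hermitian_mat (2 ^ n) (\<theta> h)" for h
    by (induction h rule: rev_induct)
      (auto simp: \<theta>_def upd_def hermitian_zero effect_hermitian split: prod.split intro!: hermitian_add_smult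
        simp del: of_real_mult of_real_minus of_real_diff)
  define A where "A h = W (\<theta> h)" for h
  have states: "A h \<in> quantum_states n" for h
    by (simp add: A_def W herm)
  have "regret n (play A B T) \<le> (K + c0 + real T * q) / \<eta>"
    if legal: "legal n \<kappa> L (play A B T)" for B
  proof (rule regret_le)
    fix \<sigma> assume \<sigma>: "\<sigma> \<in> quantum_states n"
    then have \<sigma>c: "\<sigma> \<in> carrier_mat (2 ^ n) (2 ^ n)"
      by (rule state_carrier)
    define D where "D h = (\<Sum>(\<omega>, E, l)\<leftarrow>h. l (expect_val E \<omega>)) - (\<Sum>(\<omega>, E, l)\<leftarrow>h. l (expect_val E \<sigma>))"
      for h :: transcript
    have "\<eta> * D (play A B t) + V (\<theta> (map snd (play A B t))) - expect_val (\<theta> (map snd (play A B t))) \<sigma> \<le> K + real t * q"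
      if "legal n \<kappa> L (play A B t)" for t
      using that
    proof (induction t)
      case 0
      have "expect_val (0\<^sub>m (2 ^ n) (2 ^ n)) \<sigma> = 0"
        by (simp add: expect_val_eq[OF zero_carrier_mat \<sigma>c])
      then show ?case
        using V0 by (simp add: D_def \<theta>_def)
    next
      case (Suc t)
      define h where "h = play A B t"
      define P where "P = \<theta> (map snd h)"
      obtain E l where El: "B h (A (map snd h)) = (E, l)"
        by (cases "B h (A (map snd h))")
      have play: "play A B (Suc t) = h @ [(W P, E, l)]"
        by (simp add: Let_def h_def[symmetric] El[symmetric]) (simp add: A_def P_def)
      have E: "E \<in> effects n" "sparse_mat \<kappa> E" and l: "convex_on UNIV l" "L-lipschitz_on UNIV l"
        and IH: "\<eta> * D h + V P - expect_val P \<sigma> \<le> K + real t * q"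
        using Suc unfolding play by (auto simp: h_def P_def)
      define c where "c = slope l (expect_val E (W P))"
      have sub: "\<forall>y. l (expect_val E (W P)) + c * (y - expect_val E (W P)) \<le> l y"
        unfolding c_def slope_def by (rule someI_ex) (rule convex_lipschitz_subgradient(1)[OF l])
      then have "\<bar>c\<bar> \<le> L"
        by (rule convex_lipschitz_subgradient(2)[OF l])
      then have ceta: "\<bar>- \<eta> * c\<bar> \<le> \<eta> * L"
        using eta by (simp add: abs_mult)
      have P: "hermitian_mat (2 ^ n) P"
        by (simp add: P_def herm)
      define P' where "P' = P + complex_of_real (- \<eta> * c) \<cdot>\<^sub>m E"
      have \<theta>': "\<theta> (map snd (play A B (Suc t))) = P'"
        unfolding play by (simp add: \<theta>_def upd_def E P'_def c_def) (simp add: P_def \<theta>_def)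
      \<comment> \<open>\<open>V\<close> moves by \<open>- \<eta> * c\<close> times the expectation
        in \<open>W P\<close>, up to \<open>q\<close>, and the comparison term by the same multiple
        of the expectation in \<open>\<sigma>\<close>. The difference cancels the linearized loss
        gap, which dominates the true one.\<close>
      have "V P' \<le> V P + - \<eta> * c * expect_val E (W P) + q"
        unfolding P'_def by (rule V_step[OF P E ceta])
      moreover have "expect_val P' \<sigma> = expect_val P \<sigma> + - \<eta> * c * expect_val E \<sigma>"
        unfolding P'_def
        using P effect_hermitian[OF E(1)] \<sigma>c by (intro expect_val_add_smult) (simp_all add: hermitian_mat_def)
      moreover have "\<eta> * D (play A B (Suc t)) = \<eta> * D h + \<eta> * (l (expect_val E (W P)) - l (expect_val E \<sigma>))"
        unfolding play by (simp add: D_def algebra_simps)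
      moreover have "\<eta> * (l (expect_val E (W P)) - l (expect_val E \<sigma>)) \<le> \<eta> * (c * (expect_val E (W P) - expect_val E \<sigma>))"
        using sub[rule_format, of "expect_val E \<sigma>"] eta by (intro mult_left_mono) (auto simp: algebra_simps)
      ultimately show ?case
        unfolding \<theta>' using IH by (simp add: algebra_simps del: play.simps)
    qed
    from this[OF legal] have "\<eta> * D (play A B T) \<le> K + c0 + real T * q"
      using dual[OF herm \<sigma>, of "map snd (play A B T)"] by linarith
    then show "(\<Sum>(\<omega>, E, l)\<leftarrow>play A B T. l (expect_val E \<omega>)) -
      (\<Sum>(\<omega>, E, l)\<leftarrow>play A B T. l (expect_val E \<sigma>)) \<le> (K + c0 + real T * q) / \<eta>"
      using eta by (simp add: D_def field_simps)
  qed (use states in blast)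
  with states show ?thesis
    by blast
qed

section \<open>The square and the exponential potential\<close>

text \<open>The conjugate at \<open>s \<ge> 0\<close> is half the square of \<open>s\<close>, at
  most \<open>s / 2\<close> on the unit interval; \<open>\<tau> = 0\<close> gives the starting value
  0. The response is the positive part of a shift of \<open>A\<close>, of trace 1: the Frobenius
  projection of \<open>A\<close> onto the states.\<close>

lemma spectral_potential_square:
  assumes "0 < d"
  shows "spectral_potential d (\<lambda>x. (max x 0)\<^sup>2 / 2) (\<lambda>x. max x 0) 0 (1 / 2)"
proof
  fix x y s :: real
  show "(max x 0)\<^sup>2 / 2 + (y - x) * max x 0 \<le> (max y 0)\<^sup>2 / 2"
  proof -
    have "(max y 0)\<^sup>2 - (max x 0)\<^sup>2 - 2 * (y - x) * max x 0 \<ge> (max y 0 - max x 0)\<^sup>2"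
      by (simp add: max_def power2_eq_square algebra_simps mult_nonneg_nonpos2 mult_nonneg_nonpos)
    then show ?thesis
      using zero_le_power2[of "max y 0 - max x 0"] by linarith
  qed
  show "x * s \<le> (max x 0)\<^sup>2 / 2 + 1 / 2 * s" if s: "0 \<le> s" "s \<le> 1"
  proof -
    have "x * s \<le> max x 0 * s"
      using s by (intro mult_right_mono) auto
    moreover have "0 \<le> (max x 0 - s)\<^sup>2"
      by simp
    moreover have "s\<^sup>2 \<le> s"
      using s by (simp add: power2_eq_square mult_left_le)
    ultimately show ?thesis
      by (simp add: power2_diff algebra_simps)
  qed
  show "continuous_on UNIV (\<lambda>x. max x 0 :: real)"
    by (intro continuous_intros)
  show "\<exists>y. \<forall>x\<le>y. real d * max x 0 \<le> 1"
    by (rule exI[of _ 0]) (simp add: max_def)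
  show "\<exists>x. 1 \<le> max x (0::real)"
    by (rule exI[of _ 1]) simp
  show "\<exists>\<tau>. \<tau> + real d * ((max (- \<tau>) 0)\<^sup>2 / 2) \<le> 0"
    by (rule exI[of _ 0]) simp
qed (use assms in auto)

text \<open>The minimum over \<open>\<tau>\<close> is one plus the logarithm of the sum of
  \<open>exp (a i)\<close>, and the response is the Gibbs state. The starting value is taken at
  \<open>\<tau> = ln d\<close>; the conjugate \<open>s * ln s - s\<close> is at most
  \<open>- s\<close> on the unit interval, whence \<open>- 1\<close>.\<close>

lemma spectral_potential_exp:
  assumes "0 < d"
  shows "spectral_potential d exp exp (ln (real d) + 1) (- 1)"
proof
  fix x y s :: real
  show "exp x + (y - x) * exp x \<le> exp y"
  proof -
    have "exp x * (1 + (y - x)) \<le> exp x * exp (y - x)"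
      by (intro mult_left_mono exp_ge_add_one_self) simp
    also have "\<dots> = exp y"
      by (simp flip: exp_add)
    finally show ?thesis
      by (simp add: algebra_simps)
  qed
  show "x * s \<le> exp x + - 1 * s" if s: "0 \<le> s" "s \<le> 1"
  proof -
    have "(1 + x) * s \<le> exp x * s"
      using s by (intro mult_right_mono exp_ge_add_one_self)
    also have "\<dots> \<le> exp x"
      using s by (simp add: mult_left_le)
    finally show ?thesis
      by (simp add: algebra_simps)
  qed
  show "continuous_on UNIV (exp :: real \<Rightarrow> real)"
    by (intro continuous_intros)
  show "\<exists>y. \<forall>x\<le>y. real d * exp x \<le> 1"
  proof (intro exI allI impI)
    fix x assume "x \<le> - ln (real d)"
    then have "exp x \<le> exp (- ln (real d))"
      by simp
    then show "real d * exp x \<le> 1"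
      using assms by (simp add: exp_minus field_simps)
  qed
  show "\<exists>x::real. 1 \<le> exp x"
    by (rule exI[of _ 0]) simp
  show "\<exists>\<tau>. \<tau> + real d * exp (- \<tau>) \<le> ln (real d) + 1"
    using assms by (intro exI[of _ "ln (real d)"]) (simp add: exp_minus)
qed (use assms in auto)

text \<open>Only a constant weight 1/2 occurs, so the remainder runs evenly over a whole orthonormal
  basis and adds up to half the squared Frobenius norm.\<close>

lemma klein_square:
  assumes A: "hermitian_mat d A" and B: "hermitian_mat d B" and AB: "hermitian_mat d (A + B)"
    and u: "eigenbasis d A u a" and v: "eigenbasis d (A + B) v b"
  shows "(\<Sum>j<d. (max (b j - \<tau>) 0)\<^sup>2 / 2) \<le> (\<Sum>i<d. (max (a i - \<tau>) 0)\<^sup>2 / 2)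
    + (\<Sum>i<d. max (a i - \<tau>) 0 * qform d B (u i)) + (\<Sum>k<d. \<Sum>l<d. (cmod (B $$ (k, l)))\<^sup>2) / 2"
proof -
  \<comment> \<open>If \<open>x \<le> \<tau>\<close>, the terms in \<open>max (x - \<tau>) 0\<close>
    vanish and \<open>max (y - \<tau>) 0\<close> is at most \<open>\<bar>y - x\<bar>\<close>;
    otherwise dropping the maximum at \<open>y\<close> leaves a polynomial identity.\<close>
  have scalar: "(max (y - \<tau>) 0)\<^sup>2 / 2 \<le> (max (x - \<tau>) 0)\<^sup>2 / 2 + (y - x) * max (x - \<tau>) 0 + (y - x)\<^sup>2 * (0 + 1 / 2)"
    for x y :: real
  proof (cases "x \<le> \<tau>")
    case True
    have "max (y - \<tau>) 0 \<le> \<bar>y - x\<bar>"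
      using True by simp
    then have "(max (y - \<tau>) 0)\<^sup>2 \<le> (y - x)\<^sup>2"
      using power_mono[of "max (y - \<tau>) 0" "\<bar>y - x\<bar>" 2] by simp
    then show ?thesis
      using True by (simp add: max_def)
  next
    case False
    have "(max (y - \<tau>) 0)\<^sup>2 / 2 \<le> (y - \<tau>)\<^sup>2 / 2"
      by (simp add: max_def)
    also have "\<dots> = (x - \<tau>)\<^sup>2 / 2 + (y - x) * (x - \<tau>) + (y - x)\<^sup>2 * (0 + 1 / 2)"
      by (simp add: power2_eq_square field_simps)
    also have "x - \<tau> = max (x - \<tau>) 0"
      using False by simp
    finally show ?thesis .
  qed
  show ?thesis
    using klein_second_order[OF A B AB u v, of "\<lambda>x. (max (x - \<tau>) 0)\<^sup>2 / 2" "\<lambda>x. max (x - \<tau>) 0" "\<lambda>_. 0" "\<lambda>_. 1 / 2"]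
      scalar sum_sqnorm_mat_app[OF u, of B]
    by (simp add: sum_divide_distrib[symmetric])
qed

text \<open>Arithmetic-geometric mean inequality in each coordinate; it bounds the first-order term
  in \<open>klein_exp\<close>.\<close>

lemma qform_le: "qform d B x \<le> (sqnorm d (mat_app d B x) + sqnorm d x) / 2"
proof -
  have "Re (z * cnj w) \<le> ((cmod z)\<^sup>2 + (cmod w)\<^sup>2) / 2" for z w
  proof -
    have "Re (z * cnj w) \<le> cmod z * cmod w"
      by (metis complex_Re_le_cmod complex_mod_cnj norm_mult)
    then show ?thesis
      using zero_le_power2[of "cmod z - cmod w"] by (simp add: power2_diff)
  qed
  then have "qform d B x \<le> (\<Sum>k<d. ((cmod (mat_app d B x k))\<^sup>2 + (cmod (x k))\<^sup>2) / 2)"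
    unfolding qform_def cinner_def Re_sum by (rule sum_mono)
  then show ?thesis
    by (simp add: sqnorm_def sum.distrib add_divide_distrib sum_divide_distrib)
qed

text \<open>\<open>\<beta>\<close> bounds the squared operator norm of \<open>B\<close>. The
  remainder has exponential weights at both ends, so the sum \<open>S\<close> over the new spectrum
  reappears multiplied by \<open>\<beta>\<close>; a crude bound \<open>S \<le> 3\<close> absorbs it
  and yields \<open>3 * \<beta> + \<beta>\<close>.\<close>

lemma klein_exp:
  assumes A: "hermitian_mat d A" and B: "hermitian_mat d B" and AB: "hermitian_mat d (A + B)"
    and u: "eigenbasis d A u a" and v: "eigenbasis d (A + B) v b"
    and one: "(\<Sum>i<d. exp (a i - \<tau>)) = 1"
    and contr: "\<And>x. sqnorm d (mat_app d B x) \<le> \<beta> * sqnorm d x" and \<beta>: "0 \<le> \<beta>" "\<beta> \<le> 1 / 4"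
  shows "(\<Sum>j<d. exp (b j - \<tau>)) \<le> (\<Sum>i<d. exp (a i - \<tau>))
    + (\<Sum>i<d. exp (a i - \<tau>) * qform d B (u i)) + 4 * \<beta>"
proof -
  have scalar: "exp (y - \<tau>) \<le> exp (x - \<tau>) + (y - x) * exp (x - \<tau>) + (y - x)\<^sup>2 * (exp (y - \<tau>) + exp (x - \<tau>))"
    for x y :: real
  proof -
    define t where "t = y - x"
    have upper: "exp t - 1 \<le> t * exp t"
      using mult_right_mono[OF exp_ge_add_one_self[of "- t"], of "exp t"]
      by (simp add: algebra_simps flip: exp_add)
    \<comment> \<open>By \<open>upper\<close>, \<open>exp t - 1\<close> is at most
      \<open>t + t * (exp t - 1)\<close>. The last product is at most
      \<open>t\<^sup>2 * exp t\<close> for \<open>t \<ge> 0\<close> and at most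
      \<open>t\<^sup>2\<close> for \<open>t < 0\<close>, hence the weight
      \<open>exp t + 1\<close>.\<close>
    have "exp t \<le> 1 + t + t\<^sup>2 * (exp t + 1)"
    proof (cases "0 \<le> t")
      case True
      have "t * (exp t - 1) \<le> t * (t * exp t)"
        by (rule mult_left_mono[OF upper True])
      moreover have "0 \<le> t * t"
        by simp
      ultimately show ?thesis
        using upper by (simp only: power2_eq_square algebra_simps)
    next
      case False
      have "t * (exp t - 1) \<le> t * t"
      proof (rule mult_left_mono_neg)
        show "t \<le> exp t - 1"
          using exp_ge_add_one_self[of t] by linarith
      qed (use False in simp)
      moreover have "0 \<le> t * t * exp t"
        by simp
      ultimately show ?thesis
        using upper by (simp only: power2_eq_square algebra_simps)
    qed
    then have "exp (x - \<tau>) * exp t \<le> exp (x - \<tau>) * (1 + t + t\<^sup>2 * (exp t + 1))"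
      by (intro mult_left_mono) auto
    also have "\<dots> = exp (x - \<tau>) + t * exp (x - \<tau>) + t\<^sup>2 * (exp (x - \<tau>) * exp t + exp (x - \<tau>))"
      by (simp add: algebra_simps)
    also have "exp (x - \<tau>) * exp t = exp (y - \<tau>)"
      by (simp add: t_def flip: exp_add)
    finally show ?thesis
      by (simp only: t_def)
  qed
  define S where "S = (\<Sum>j<d. exp (b j - \<tau>))"
  define q where "q = (\<Sum>i<d. exp (a i - \<tau>) * qform d B (u i))"
  have contr_u: "sqnorm d (mat_app d B (u i)) \<le> \<beta>" "sqnorm d (mat_app d B (v i)) \<le> \<beta>" if "i < d" for i
    using contr[of "u i"] contr[of "v i"] that
    by (simp_all add: eigenbasis_sqnorm[OF u] eigenbasis_sqnorm[OF v])
  have "S \<le> 1 + q + (\<Sum>j<d. exp (b j - \<tau>) * sqnorm d (mat_app d B (v j)))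
      + (\<Sum>i<d. exp (a i - \<tau>) * sqnorm d (mat_app d B (u i)))"
    unfolding S_def q_def one[symmetric] by (rule klein_second_order[OF A B AB u v scalar])
  also have "\<dots> \<le> 1 + q + (\<Sum>j<d. exp (b j - \<tau>) * \<beta>) + (\<Sum>i<d. exp (a i - \<tau>) * \<beta>)"
    by (intro add_mono sum_mono mult_left_mono) (auto simp: contr_u)
  also have "\<dots> = 1 + q + S * \<beta> + \<beta>"
    by (simp add: S_def sum_distrib_right[symmetric] one)
  finally have main: "S \<le> 1 + q + S * \<beta> + \<beta>" .
  \<comment> \<open>On each eigenvector the form is at most
    \<open>(\<beta> + 1) / 2 \<le> 5 / 8\<close>. With \<open>S * \<beta> \<le> S / 4\<close>,
    \<open>main\<close> then gives \<open>S \<le> 5 / 2\<close>, rounded up to 3.\<close>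
  have "q \<le> (\<Sum>i<d. exp (a i - \<tau>) * (5 / 8))"
    unfolding q_def
  proof (intro sum_mono mult_left_mono)
    fix i assume "i \<in> {..<d}"
    then show "qform d B (u i) \<le> 5 / 8"
      using qform_le[of d B "u i"] contr_u(1)[of i] \<beta> by (simp add: eigenbasis_sqnorm[OF u])
  qed simp
  then have "q \<le> 5 / 8"
    by (simp only: sum_distrib_right[symmetric] one)
  moreover have "S * \<beta> \<le> S * (1 / 4)"
    using \<beta> by (intro mult_left_mono) (auto simp: S_def intro: sum_nonneg)
  ultimately have "S \<le> 3"
    using main \<beta> by simp
  then have "S * \<beta> \<le> 3 * \<beta>"
    using \<beta> by (intro mult_right_mono)
  then show ?thesis
    using main by (simp add: S_def[symmetric] q_def[symmetric] one)
qed

section \<open>Step sizes of the two learners\<close>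

lemma square_learner:
  assumes "0 < \<kappa>" "0 < T" "0 < L"
  shows "\<exists>A::learner. (\<forall>h. A h \<in> quantum_states n) \<and>
    (\<forall>B. legal n \<kappa> L (play A B T) \<longrightarrow> regret n (play A B T) \<le> L * sqrt (real \<kappa> * real T))"
proof -
  let ?d = "2 ^ n :: nat"
  interpret spectral_potential ?d "\<lambda>x. (max x 0)\<^sup>2 / 2" "\<lambda>x. max x 0" 0 "1 / 2"
    by (rule spectral_potential_square) simp
  define s where "s = sqrt (real \<kappa> * real T)"
  \<comment> \<open>This makes the total remainder over \<open>T\<close> rounds 1/2, equal to the
    conjugate constant; the bound becomes \<open>1 / \<eta>\<close>.\<close>
  define \<eta> where "\<eta> = 1 / (L * s)"
  have s: "0 < s" "s\<^sup>2 = real \<kappa> * real T"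
    using assms by (simp_all add: s_def)
  then have \<eta>: "0 < \<eta>"
    using assms by (simp add: \<eta>_def)
  have step: "pot (A + complex_of_real c \<cdot>\<^sub>m E) \<le> pot A + c * expect_val E (response A) + (\<eta> * L)\<^sup>2 * real \<kappa> / 2"
    if A: "hermitian_mat ?d A" and E: "E \<in> effects n" "sparse_mat \<kappa> E" and c: "\<bar>c\<bar> \<le> \<eta> * L" for A E c
  proof -
    let ?B = "complex_of_real c \<cdot>\<^sub>m E"
    note B = hermitian_smult[OF effect_hermitian[OF E(1)], of c]
    note AB = hermitian_add_smult[OF A effect_hermitian[OF E(1)], of c]
    have "(\<Sum>k<?d. \<Sum>l<?d. (cmod (?B $$ (k, l)))\<^sup>2) = c\<^sup>2 * (\<Sum>k<?d. \<Sum>l<?d. (cmod (E $$ (k, l)))\<^sup>2)"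
      using effect_carrier[OF E(1)] by (simp add: norm_mult power_mult_distrib sum_distrib_left)
    also have "\<dots> \<le> (\<eta> * L)\<^sup>2 * real \<kappa>"
      using c by (intro mult_mono sparse_effect_frobenius[OF E] sum_nonneg) (auto simp: abs_le_square_iff[symmetric])
    finally have "pot (A + ?B) \<le> pot A + expect_val ?B (response A) + (\<eta> * L)\<^sup>2 * real \<kappa> / 2"
      by (intro pot_step[OF A B AB] order.trans[OF klein_square[OF A B AB]]) auto
    also have "expect_val ?B (response A) = c * expect_val E (response A)"
      by (rule expect_val_smult[OF effect_carrier[OF E(1)] state_carrier[OF response_state[OF refl A]]])
    finally show ?thesis .
  qed
  have dual: "expect_val A \<sigma> \<le> pot A + 1 / 2" if "hermitian_mat ?d A" "\<sigma> \<in> quantum_states n" for A \<sigma>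
    using expect_val_le_pot[OF that(1)] that(2) by (simp add: quantum_states_def)
  have bound: "(0 + 1 / 2 + real T * ((\<eta> * L)\<^sup>2 * real \<kappa> / 2)) / \<eta> = L * s"
  proof -
    have "(\<eta> * L)\<^sup>2 = 1 / s\<^sup>2"
      using assms by (simp add: \<eta>_def power_divide)
    then have "real T * ((\<eta> * L)\<^sup>2 * real \<kappa> / 2) = 1 / 2"
      using assms by (simp add: s(2))
    then show ?thesis
      by (simp add: \<eta>_def)
  qed
  show ?thesis
    unfolding s_def[symmetric] bound[symmetric]
    by (rule dual_averaging_regret[where W = response and V = pot, OF \<eta> response_state[OF refl] pot_zero_le step dual])
qed

lemma exp_learner:
  assumes "0 < n" "n \<le> T" "0 < L"
  shows "\<exists>A::learner. (\<forall>h. A h \<in> quantum_states n) \<and>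
    (\<forall>B. legal n \<kappa> L (play A B T) \<longrightarrow> regret n (play A B T) \<le> 4 * L * sqrt (real n * real T))"
proof -
  let ?d = "2 ^ n :: nat"
  interpret spectral_potential ?d exp exp "ln (real ?d) + 1" "- 1"
    by (rule spectral_potential_exp) simp
  define s where "s = sqrt (real n * real T)"
  \<comment> \<open>This is \<open>sqrt (n / T) / (2 * L)\<close>: the total remainder becomes
    \<open>n\<close>, comparable to the initial \<open>n * ln 2\<close>, and
    \<open>n \<le> T\<close> yields the \<open>(\<eta> * L)\<^sup>2 \<le> 1 / 4\<close> that
    \<open>klein_exp\<close> demands.\<close>
  define \<eta> where "\<eta> = real n / (2 * L * s)"
  have s: "0 < s" "s\<^sup>2 = real n * real T"
    using assms by (simp_all add: s_def)
  then have \<eta>: "0 < \<eta>"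
    using assms by (simp add: \<eta>_def)
  have \<eta>L: "\<eta> * L = real n / s / 2"
    using assms by (simp add: \<eta>_def)
  have \<eta>L2: "(\<eta> * L)\<^sup>2 = real n / real T / 4"
    using assms s by (simp add: \<eta>L power_divide s(2) power2_eq_square[of "real n"])
  have \<eta>L4: "(\<eta> * L)\<^sup>2 \<le> 1 / 4"
    using assms by (simp add: \<eta>L2)
  have step: "pot (A + complex_of_real c \<cdot>\<^sub>m E) \<le> pot A + c * expect_val E (response A) + 4 * (\<eta> * L)\<^sup>2"
    if A: "hermitian_mat ?d A" and E: "E \<in> effects n" "sparse_mat \<kappa> E" and c: "\<bar>c\<bar> \<le> \<eta> * L" for A E c
  proof -
    let ?B = "complex_of_real c \<cdot>\<^sub>m E"
    note B = hermitian_smult[OF effect_hermitian[OF E(1)], of c]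
    note AB = hermitian_add_smult[OF A effect_hermitian[OF E(1)], of c]
    have "c\<^sup>2 \<le> (\<eta> * L)\<^sup>2"
      using c by (auto simp: abs_le_square_iff[symmetric])
    then have contr: "sqnorm ?d (mat_app ?d ?B x) \<le> (\<eta> * L)\<^sup>2 * sqnorm ?d x" for x
      unfolding sqnorm_mat_app_smult[OF effect_carrier[OF E(1)]]
      by (intro mult_mono effect_contraction[OF E(1)]) (auto simp: sqnorm_nonneg)
    have "pot (A + ?B) \<le> pot A + expect_val ?B (response A) + 4 * (\<eta> * L)\<^sup>2"
      by (rule pot_step[OF A B AB]) (rule klein_exp[OF A B AB _ _ _ contr _ \<eta>L4], auto)
    also have "expect_val ?B (response A) = c * expect_val E (response A)"
      by (rule expect_val_smult[OF effect_carrier[OF E(1)] state_carrier[OF response_state[OF refl A]]])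
    finally show ?thesis .
  qed
  have "(ln (real ?d) + 1 + - 1 + real T * (4 * (\<eta> * L)\<^sup>2)) / \<eta> = (real n * ln 2 + real n) / \<eta>"
    using assms by (simp add: \<eta>L2 ln_realpow)
  also have "\<dots> \<le> (real n * 1 + real n) / \<eta>"
    using \<eta> ln_2_less_1 by (intro divide_right_mono add_mono mult_left_mono) auto
  also have "\<dots> = 4 * L * s"
    using assms by (simp add: \<eta>_def)
  finally have bound: "(ln (real ?d) + 1 + - 1 + real T * (4 * (\<eta> * L)\<^sup>2)) / \<eta> \<le> 4 * L * s" .
  have dual: "expect_val A \<sigma> \<le> pot A + - 1" if "hermitian_mat ?d A" "\<sigma> \<in> quantum_states n" for A \<sigma>
    using expect_val_le_pot[OF that(1)] that(2) by (simp add: quantum_states_def)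
  have "\<exists>A::learner. (\<forall>h. A h \<in> quantum_states n) \<and>
    (\<forall>B. legal n \<kappa> L (play A B T) \<longrightarrow> regret n (play A B T) \<le> (ln (real ?d) + 1 + - 1 + real T * (4 * (\<eta> * L)\<^sup>2)) / \<eta>)"
    by (rule dual_averaging_regret[where W = response and V = pot, OF \<eta> response_state[OF refl] pot_zero_le step dual])
  with bound show ?thesis
    unfolding s_def by (meson order.trans)
qed

section \<open>The trivial bound and the three regimes\<close>

text \<open>An expectation value averages the eigenvalues of \<open>E\<close>, all between 0 and 1,
  with the diagonal of the state in the eigenbasis as weights.\<close>

lemma expect_val_effect_bounds:
  assumes E: "E \<in> effects n" and \<sigma>: "\<sigma> \<in> quantum_states n"
  shows "0 \<le> expect_val E \<sigma>" "expect_val E \<sigma> \<le> 1"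
proof -
  let ?d = "2 ^ n :: nat"
  note c = effect_carrier[OF E] state_carrier[OF \<sigma>]
  have E0: "\<And>x. 0 \<le> qform ?d E x" and E1: "\<And>x. 0 \<le> qform ?d (1\<^sub>m ?d - E) x"
    using E by (simp_all add: effects_def psd_mat_iff)
  have \<sigma>0: "\<And>x. 0 \<le> qform ?d \<sigma> x"
    using \<sigma> by (simp add: quantum_states_def psd_mat_iff)
  obtain u ev where u: "eigenbasis ?d E u ev"
    using hermitian_eigenbasis[OF effect_hermitian[OF E]] by blast
  have ev: "0 \<le> ev i \<and> ev i \<le> 1" if "i < ?d" for i
    using E0[of "u i"] E1[of "u i"] that
    by (simp add: qform_one_minus[OF c(1)] qform_eigenvector[OF u] eigenbasis_sqnorm[OF u])
  show "0 \<le> expect_val E \<sigma>"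
    unfolding expect_val_eigenbasis[OF c u] by (intro sum_nonneg mult_nonneg_nonneg) (use ev \<sigma>0 in auto)
  have "expect_val E \<sigma> \<le> (\<Sum>i<?d. qform ?d \<sigma> (u i))"
    unfolding expect_val_eigenbasis[OF c u] by (intro sum_mono) (use ev \<sigma>0 in \<open>auto simp: mult_left_le_one_le\<close>)
  also have "\<dots> = 1"
    using \<sigma> by (simp add: sum_qform_eigenbasis[OF c(2) u] quantum_states_def)
  finally show "expect_val E \<sigma> \<le> 1" .
qed

lemma length_play: "length (play A B T) = T"
  by (induction T) (simp_all add: Let_def)

lemma play_states: "(\<And>h. A h \<in> S) \<Longrightarrow> (\<omega>, m) \<in> set (play A B T) \<Longrightarrow> \<omega> \<in> S"
  by (induction T) (auto simp: Let_def)

text \<open>Both expectation values lie in the unit interval, so a round costs at most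
  \<open>L\<close> whichever states are played.\<close>

lemma trivial_regret:
  assumes A: "\<And>h. A h \<in> quantum_states n" and legal: "legal n \<kappa> L (play A B T)" and L: "0 < L"
  shows "regret n (play A B T) \<le> L * real T"
proof (rule regret_le)
  fix \<sigma> assume \<sigma>: "\<sigma> \<in> quantum_states n"
  have "(\<Sum>(\<omega>, E, l)\<leftarrow>play A B T. l (expect_val E \<omega>)) - (\<Sum>(\<omega>, E, l)\<leftarrow>play A B T. l (expect_val E \<sigma>))
     = (\<Sum>(\<omega>, E, l)\<leftarrow>play A B T. l (expect_val E \<omega>) - l (expect_val E \<sigma>))"
    by (simp add: case_prod_unfold sum_list_subtractf)
  also have "\<dots> \<le> (\<Sum>_\<leftarrow>play A B T. L)"
  proof (intro sum_list_mono, clarify)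
    fix \<omega> E l assume mem: "(\<omega>, E, l) \<in> set (play A B T)"
    then have E: "E \<in> effects n" and l: "L-lipschitz_on UNIV l"
      using legal by auto
    have \<omega>: "\<omega> \<in> quantum_states n"
      using play_states[OF A mem] .
    have "l (expect_val E \<omega>) - l (expect_val E \<sigma>) \<le> L * \<bar>expect_val E \<omega> - expect_val E \<sigma>\<bar>"
      using lipschitz_onD[OF l, of "expect_val E \<omega>" "expect_val E \<sigma>"] by (simp add: dist_real_def)
    also have "\<dots> \<le> L * 1"
      using expect_val_effect_bounds[OF E \<omega>] expect_val_effect_bounds[OF E \<sigma>] L
      by (intro mult_left_mono) auto
    finally show "l (expect_val E \<omega>) - l (expect_val E \<sigma>) \<le> L"
      by simp
  qed
  also have "\<dots> = L * real T"
    by (simp add: sum_list_triv length_play)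
  finally show "(\<Sum>(\<omega>, E, l)\<leftarrow>play A B T. l (expect_val E \<omega>)) -
    (\<Sum>(\<omega>, E, l)\<leftarrow>play A B T. l (expect_val E \<sigma>)) \<le> L * real T" .
qed (use A in blast)

theorem corollary2p4:
  shows "\<exists>C::real. C > 0 \<and>
    (\<forall>(n::nat) (T::nat) (\<kappa>::nat) (L::real). n \<ge> 1 \<longrightarrow> T \<ge> 1 \<longrightarrow> \<kappa> \<ge> 1 \<longrightarrow> L > 0 \<longrightarrow>
      (\<exists>A::learner. (\<forall>h. A h \<in> quantum_states n) \<and>
        (\<forall>B::adversary.
          (\<forall>(\<omega>, E, l)\<in>set (play A B T).
             E \<in> effects n \<and> sparse_mat \<kappa> E \<and> convex_on UNIV l \<and> L-lipschitz_on UNIV l) \<longrightarrow>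
          regret n (play A B T) \<le> C * L * sqrt (real (min \<kappa> n) * real T))))"
proof (intro exI[of _ 4] conjI allI impI)
  fix n T \<kappa> :: nat and L :: real
  assume pos: "1 \<le> n" "1 \<le> T" "1 \<le> \<kappa>" "0 < L"
  obtain A0 :: learner where A0: "\<And>h. A0 h \<in> quantum_states n"
    "\<And>B. legal n \<kappa> L (play A0 B T) \<Longrightarrow> regret n (play A0 B T) \<le> L * sqrt (real \<kappa> * real T)"
    using square_learner[of \<kappa> T L n] pos by auto
  \<comment> \<open>The square potential covers \<open>\<kappa> \<le> n\<close>, the exponential one
    \<open>n \<le> T\<close>. For \<open>T \<le> n\<close> already
    \<open>L * T \<le> L * sqrt (n * T)\<close>, so any learner that outputs states will do, here
    \<open>A0\<close>. The constant 4 is that of \<open>exp_learner\<close>.\<close>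
  consider "\<kappa> \<le> n" | "n \<le> \<kappa>" "n \<le> T" | "n \<le> \<kappa>" "T \<le> n"
    by linarith
  then show "\<exists>A::learner. (\<forall>h. A h \<in> quantum_states n) \<and>
    (\<forall>B. legal n \<kappa> L (play A B T) \<longrightarrow> regret n (play A B T) \<le> 4 * L * sqrt (real (min \<kappa> n) * real T))"
  proof cases
    case 1
    have "L * sqrt (real \<kappa> * real T) \<le> 4 * L * sqrt (real (min \<kappa> n) * real T)"
      using 1 pos by (simp add: min_def)
    with A0 show ?thesis
      by (meson order.trans)
  next
    case 2
    then show ?thesis
      using exp_learner[of n T L \<kappa>] pos by (simp add: min_absorb2)
  next
    case 3
    have "L * real T = L * sqrt (real T * real T)"
      by simp
    also have "\<dots> \<le> L * sqrt (real n * real T)"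
      using 3 pos by (intro mult_left_mono real_sqrt_le_mono mult_right_mono) auto
    also have "\<dots> \<le> 4 * L * sqrt (real (min \<kappa> n) * real T)"
      using 3 pos by (simp add: min_absorb2)
    finally have "L * real T \<le> 4 * L * sqrt (real (min \<kappa> n) * real T)" .
    then have "regret n (play A0 B T) \<le> 4 * L * sqrt (real (min \<kappa> n) * real T)"
      if "legal n \<kappa> L (play A0 B T)" for B
      using trivial_regret[OF A0(1) that pos(4)] by linarith
    with A0(1) show ?thesis
      by blast
  qed
qed simp

end
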